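(* Let $E$ be a Polish space with $\mathcal{E}=\mathcal{B}(E)$ its Borel $\sigma$-field, let $(\Omega,\mathcal{A},P)$ be a probability space with a filtration $\mathcal{G}=(\mathcal{G}_n)_{n\ge0}$, and let $(X_n)_{n\ge1}$ be a $\mathcal{G}$-c.i.d. sequence of $E$-valued random variables with directing measure $\alpha$. Then the sequence of $E^\infty$-valued random variables $[X_n,X_{n+1},\dots]$, $n\ge 1$, converges stably with representing measure $\alpha^\infty=\alpha\times\alpha\times\cdots$, and $$E[g(X_{n+1},X_{n+2},\dots)\mid\mathcal{G}_n]\;\to\;\int g(x)\,\alpha^\infty(\cdot)(dx)\qquad\text{a.s. for each } g\in C_b(E^\infty).$$
   Context: $(X_n)_{n\ge1}$ is $\mathcal{G}$-c.i.d. (conditionally identically distributed with respect to $\mathcal{G}$) if it is adapted to $\mathcal{G}$ and, for all $k>n\ge0$ and all bounded measurable $f:E\to\mathbb{R}$, $E[f(X_k)\mid\mathcal{G}_n]=E[f(X_{n+1})\mid\mathcal{G}_n]$ a.s. In that case, for each measurable $f:E\to\mathbb R$ with $E[|f(X_1)|]<\infty$, $E[f(X_{n+1})\mid\mathcal{G}_n]$ converges a.s. and in $L^1$ to an integrable random variable, denoted $V_f$. For a Polish space $S$, $C_b(S)$ is the space of bounded continuous real functions on $S$. A random measure on $S$ is a map $\gamma$ from $\Omega$ to the set of probability measures on $\mathcal{B}(S)$ such that $\omega\mapsto\gamma(\omega)(B)$ is $\mathcal{A}$-measurable for each $B\in\mathcal{B}(S)$. A sequence $(Z_n)_n$ of $S$-valued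 random variables on $(\Omega,\mathcal{A},P)$ converges stably with representing measure $\gamma$ (a random measure on $S$) if, for every $H\in\mathcal{A}$ with $P(H)>0$, $(Z_n)_n$ converges in distribution under $P(\cdot\mid H)$ to the law $\mu_H(\cdot)=\int\gamma(\omega)(\cdot)\,P(d\omega\mid H)$. The directing measure of the $\mathcal{G}$-c.i.d. sequence $(X_n)_n$ is the (a.s. unique) random measure $\alpha$ on $E$ such that $V_f=\int f(t)\,\alpha(\cdot)(dt)$ a.s. for all $f\in C_b(E)$; it always exists when $E$ is Polish. $\alpha^\infty(\omega)$ is the infinite product probability measure $\alpha(\omega)\times\alpha(\omega)\times\cdots$ on $E^\infty$. *)

theory Defs
  imports "HOL-Probability.Probability"
begin

text \<open>
  Sequences indexed by $n \ge 1$ are functions on \<open>nat\<close> whose value at 0 is irrelevant.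
\<close>

text \<open>
  The \<open>\<sigma>\<close>-algebra of \<^term>\<open>prob_algebra borel\<close> is generated by the evaluations at Borel sets, so
  measurability means that \<open>\<omega> \<mapsto> \<gamma>(\<omega>)(B)\<close> is measurable for each Borel set \<open>B\<close>.
\<close>

definition random_measure :: "'a measure \<Rightarrow> ('a \<Rightarrow> 's::polish_space measure) \<Rightarrow> bool" where
  "random_measure M \<gamma> \<longleftrightarrow> \<gamma> \<in> M \<rightarrow>\<^sub>M prob_algebra borel"

definition weakly_converges ::
    "(nat \<Rightarrow> 's::polish_space measure) \<Rightarrow> 's measure \<Rightarrow> bool" where
  "weakly_converges \<mu> \<nu> \<longleftrightarrow>
     (\<forall>f::'s \<Rightarrow> real. f \<in> bcontfun \<longrightarrow>
        (\<lambda>n. integral\<^sup>L (\<mu> n) f) \<longlonglongrightarrow> integral\<^sup>L \<nu> f)"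

text \<open>
  \<^term>\<open>uniform_measure M H\<close> is $P(\cdot \mid H)$, and the monadic \<^term>\<open>bind\<close> of it with
  \<open>\<gamma>\<close> is the mixture $\mu_H(B) = \int \gamma(\omega)(B) \, P(d\omega \mid H)$.
\<close>

definition converges_stably ::
    "'a measure \<Rightarrow> (nat \<Rightarrow> 'a \<Rightarrow> 's::polish_space) \<Rightarrow> ('a \<Rightarrow> 's measure) \<Rightarrow> bool" where
  "converges_stably M Z \<gamma> \<longleftrightarrow>
     (\<forall>n\<ge>1. Z n \<in> borel_measurable M) \<and>
     random_measure M \<gamma> \<and>
     (\<forall>H\<in>sets M. measure M H > 0 \<longrightarrow>
        weakly_converges (\<lambda>n. distr (uniform_measure M H) borel (Z (Suc n)))
          (bind (uniform_measure M H) \<gamma>))"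

definition cid ::
    "'a measure \<Rightarrow> (nat \<Rightarrow> 'a measure) \<Rightarrow> (nat \<Rightarrow> 'a \<Rightarrow> 'e::polish_space) \<Rightarrow> bool" where
  "cid M G X \<longleftrightarrow>
     (\<forall>n\<ge>1. X n \<in> borel_measurable (G n)) \<and>
     (\<forall>n k. n < k \<longrightarrow> (\<forall>f::'e \<Rightarrow> real. f \<in> borel_measurable borel \<longrightarrow> bounded (range f) \<longrightarrow>
        (AE \<omega> in M. real_cond_exp M (G n) (\<lambda>\<omega>'. f (X k \<omega>')) \<omega> =
                    real_cond_exp M (G n) (\<lambda>\<omega>'. f (X (n + 1) \<omega>')) \<omega>)))"

text \<open>
  The random variable $V_f$. The limit exists almost surely if \<open>X\<close> is c.i.d.\ and \<open>f(X\<^sub>1)\<close> is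
  integrable; elsewhere the value is arbitrary.
\<close>

definition cid_limit ::
    "'a measure \<Rightarrow> (nat \<Rightarrow> 'a measure) \<Rightarrow> (nat \<Rightarrow> 'a \<Rightarrow> 'e) \<Rightarrow> ('e \<Rightarrow> real) \<Rightarrow> 'a \<Rightarrow> real" where
  "cid_limit M G X f \<omega> =
     lim (\<lambda>n. real_cond_exp M (G n) (\<lambda>\<omega>'. f (X (n + 1) \<omega>')) \<omega>)"

definition directing_measure ::
    "'a measure \<Rightarrow> (nat \<Rightarrow> 'a measure) \<Rightarrow> (nat \<Rightarrow> 'a \<Rightarrow> 'e::polish_space) \<Rightarrow>
     ('a \<Rightarrow> 'e measure) \<Rightarrow> bool" where
  "directing_measure M G X \<alpha> \<longleftrightarrow>
     random_measure M \<alpha> \<and>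
     (\<forall>f::'e \<Rightarrow> real. f \<in> bcontfun \<longrightarrow>
        (AE \<omega> in M. cid_limit M G X f \<omega> = (\<integral>t. f t \<partial>\<alpha> \<omega>)))"

text \<open>
  The product \<open>\<sigma>\<close>-algebra underlying \<^term>\<open>PiM\<close> is the Borel \<open>\<sigma>\<close>-algebra of the product
  topology on \<^typ>\<open>nat \<Rightarrow> 'e\<close>, by \<open>sets_PiM_equal_borel\<close>.
\<close>

definition iid_power :: "('a \<Rightarrow> 'e::polish_space measure) \<Rightarrow> 'a \<Rightarrow> (nat \<Rightarrow> 'e) measure" where
  "iid_power \<alpha> \<omega> = PiM UNIV (\<lambda>_. \<alpha> \<omega>)"

end

theory Submission
  imports Defs
begin

text \<open>
  For a product of one-coordinate functions, conditioning successively on $\mathcal{G}_{n+1}$ and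
  $\mathcal{G}_n$ gives $E[f_1(X_{n+1}) Y_{n+1} \mid \mathcal{G}_n]$, where $Y_{n+1}$ is the
  predictive mean of the remaining factors. By induction $Y_n$ converges almost surely, so
  $Y_{n+1}$ may be replaced by $Y_n$ (Hunt's lemma) and $Y_n$ leaves the conditional expectation.
  With indicators of open sets as factors this is convergence on open cylinders, which form a
  \<open>\<pi>\<close>-system whose countable unions are the open sets of $E^\infty$; the portmanteau argument
  passes to bounded continuous functions. The same argument under $P(\cdot \mid H)$ gives stable
  convergence.
\<close>

section \<open>Maximal inequality\<close>

text \<open>Each identity between versions of \<open>real_cond_exp\<close> has its own null set, so
  every approximation must run through countably many functions fixed in advance. The directing
  measure is specified by continuous test functions alone. Hence there are two passages: from
  continuous functions to open sets in E, and, after the product argument, from open cylinders to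
  continuous functions on the sequence space. Open sets suit both: finite unions of cylinders are
  reached by inclusion-exclusion and exhaust an open set from inside, which gives a lower bound for
  the liminf; using it for g and for 1 - g gives the limit. Martingale convergence and Hunt's lemma
  rest on one maximal inequality, applied to the filtration restarted at N with a bound that
  vanishes as N grows. Conditioning on H does not preserve the c.i.d. property in general, so under
  P( . | H) only the second passage is repeated. Convergence on cylinders is transferred from the
  unconditional statement: the martingale E[1_H | G_n] converges, so what is learnt about H between
  times n and n + k is asymptotically negligible.\<close>

locale filtered_prob_space = prob_space +
  fixes G :: "nat \<Rightarrow> 'a measure"
  assumes subalg: "\<And>n. subalgebra M (G n)"
    and G_mono: "\<And>m n. m \<le> n \<Longrightarrow> sets (G m) \<subseteq> sets (G n)"
begin

sublocale cond: finite_measure_subalgebra M "G n" for n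
  by unfold_locales (rule subalg)

lemma space_G: "space (G n) = space M"
  using subalg[of n] by (simp add: subalgebra_def)

lemma sets_G_subset: "sets (G n) \<subseteq> sets M"
  using subalg[of n] by (simp add: subalgebra_def)

lemma subalg_G: "m \<le> n \<Longrightarrow> subalgebra (G n) (G m)"
  using G_mono[of m n] by (simp add: subalgebra_def space_G)

lemma measurable_G_M: "f \<in> measurable (G n) N \<Longrightarrow> f \<in> measurable M N"
  by (rule measurable_from_subalg[OF subalg])

lemma measurable_G_mono: "m \<le> n \<Longrightarrow> f \<in> measurable (G m) N \<Longrightarrow> f \<in> measurable (G n) N"
  by (rule measurable_from_subalg[OF subalg_G])

text \<open>Restarting at \<open>N\<close> turns the maximal inequality into a bound on the whole
  tail of a sequence from \<open>N\<close> on.\<close>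

lemma shifted_filtration: "filtered_prob_space M (\<lambda>n. G (N + n))"
  using subalg G_mono
  by (simp add: filtered_prob_space_def filtered_prob_space_axioms_def prob_space_axioms)

text \<open>Doob's inequality for a nonnegative submartingale. The submartingale property is
  expressed by integrals over events of \<open>G n\<close>, the form in which conditional
  expectations supply it. The induction on \<open>m\<close> carries the integral over
  \<open>B m\<close> alone; nonnegativity enlarges the domain at the end.\<close>

lemma maximal_inequality_finite:
  fixes Z :: "nat \<Rightarrow> 'a \<Rightarrow> real"
  assumes Z: "\<And>n. Z n \<in> borel_measurable (G n)" "\<And>n. integrable M (Z n)"
    and nonneg: "\<And>n. AE \<omega> in M. Z n \<omega> \<ge> 0"
    and sub: "\<And>n A. A \<in> sets (G n) \<Longrightarrow>
      (\<integral>\<omega>. indicator A \<omega> * Z n \<omega> \<partial>M) \<le> (\<integral>\<omega>. indicator A \<omega> * Z (Suc n) \<omega> \<partial>M)"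
  shows "c * prob {\<omega> \<in> space M. \<exists>n\<le>m. c \<le> Z n \<omega>} \<le> (\<integral>\<omega>. Z m \<omega> \<partial>M)"
proof -
  define B where "B m = {\<omega> \<in> space M. \<exists>n\<le>m. c \<le> Z n \<omega>}" for m
  have BG: "B m \<in> sets (G m)" for m
  proof -
    have "{\<omega> \<in> space (G m). c \<le> Z n \<omega>} \<in> sets (G m)" if "n \<le> m" for n
      using measurable_G_mono[OF that Z(1)] by (rule borel_measurable_le[OF borel_measurable_const])
    then have "(\<Union>n\<in>{..m}. {\<omega> \<in> space (G m). c \<le> Z n \<omega>}) \<in> sets (G m)"
      by (intro sets.finite_UN) auto
    moreover have "B m = (\<Union>n\<in>{..m}. {\<omega> \<in> space (G m). c \<le> Z n \<omega>})"
      by (auto simp: B_def space_G)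
    ultimately show ?thesis by simp
  qed
  have [measurable]: "B m \<in> sets M" for m using BG sets_G_subset by blast
  have ZM[measurable]: "Z n \<in> borel_measurable M" for n using Z(2) by (rule borel_measurable_integrable)
  have int: "integrable M (\<lambda>\<omega>. indicator A \<omega> * Z n \<omega>)" if "A \<in> sets M" for A n
    using integrable_mult_indicator[OF that Z(2)] by simp
  have level: "c * prob C \<le> (\<integral>\<omega>. indicator C \<omega> * Z n \<omega> \<partial>M)"
    if C[measurable]: "C \<in> sets M" and le: "\<And>\<omega>. \<omega> \<in> C \<Longrightarrow> c \<le> Z n \<omega>" for C n
  proof -
    have int_ind: "integrable M (indicator C :: 'a \<Rightarrow> real)"
      by (rule integrable_const_bound[of _ 1]) (use C in auto)
    have "c * prob C = (\<integral>\<omega>. indicator C \<omega> * c \<partial>M)"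
      by (simp add: int_ind C sets.Int_space_eq2[OF C])
    also have "\<dots> \<le> (\<integral>\<omega>. indicator C \<omega> * Z n \<omega> \<partial>M)"
      by (rule integral_mono) (auto intro!: int int_ind simp: C le split: split_indicator)
    finally show ?thesis .
  qed
  have "c * prob (B m) \<le> (\<integral>\<omega>. indicator (B m) \<omega> * Z m \<omega> \<partial>M)"
  proof (induction m)
    case 0
    show ?case by (rule level) (auto simp: B_def)
  next
    case (Suc m)
    \<comment> \<open>On \<open>?C\<close> the level is first reached at time \<open>Suc m\<close>,
      so \<open>level\<close> applies; on \<open>B m\<close>, an event of \<open>G m\<close>, the
      submartingale property passes from \<open>Z m\<close> to \<open>Z (Suc m)\<close>.\<close>
    let ?C = "B (Suc m) - B m"
    have sub_B: "B m \<subseteq> B (Suc m)" unfolding B_def using le_SucI by blast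
    have "c * prob (B (Suc m)) = c * prob (B m) + c * prob ?C"
      using sub_B by (simp add: finite_measure_Diff algebra_simps)
    also have "\<dots> \<le> (\<integral>\<omega>. indicator (B m) \<omega> * Z (Suc m) \<omega> \<partial>M) +
        (\<integral>\<omega>. indicator ?C \<omega> * Z (Suc m) \<omega> \<partial>M)"
    proof (rule add_mono)
      show "c * prob (B m) \<le> (\<integral>\<omega>. indicator (B m) \<omega> * Z (Suc m) \<omega> \<partial>M)"
        using Suc sub[OF BG, of m] by simp
      show "c * prob ?C \<le> (\<integral>\<omega>. indicator ?C \<omega> * Z (Suc m) \<omega> \<partial>M)"
        by (rule level) (simp, auto simp: B_def le_Suc_eq)
    qed
    also have "\<dots> = (\<integral>\<omega>. indicator (B m) \<omega> * Z (Suc m) \<omega> + indicator ?C \<omega> * Z (Suc m) \<omega> \<partial>M)"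
      by (intro Bochner_Integration.integral_add[symmetric] int) auto
    also have "\<dots> = (\<integral>\<omega>. indicator (B (Suc m)) \<omega> * Z (Suc m) \<omega> \<partial>M)"
      using sub_B by (intro Bochner_Integration.integral_cong) (auto split: split_indicator)
    finally show ?case .
  qed
  also have "\<dots> \<le> (\<integral>\<omega>. Z m \<omega> \<partial>M)"
    using nonneg[of m] by (intro integral_mono_AE int Z) (auto split: split_indicator)
  finally show ?thesis by (simp add: B_def)
qed

lemma maximal_inequality:
  fixes Z :: "nat \<Rightarrow> 'a \<Rightarrow> real"
  assumes Z: "\<And>n. Z n \<in> borel_measurable (G n)" "\<And>n. integrable M (Z n)"
    and nonneg: "\<And>n. AE \<omega> in M. Z n \<omega> \<ge> 0"
    and sub: "\<And>n A. A \<in> sets (G n) \<Longrightarrow>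
      (\<integral>\<omega>. indicator A \<omega> * Z n \<omega> \<partial>M) \<le> (\<integral>\<omega>. indicator A \<omega> * Z (Suc n) \<omega> \<partial>M)"
    and bound: "\<And>n. (\<integral>\<omega>. Z n \<omega> \<partial>M) \<le> K" and "c > 0"
  shows "prob {\<omega> \<in> space M. \<exists>n. c \<le> Z n \<omega>} \<le> K / c"
proof -
  let ?B = "\<lambda>m. {\<omega> \<in> space M. \<exists>n\<le>m. c \<le> Z n \<omega>}"
  have [measurable]: "Z n \<in> borel_measurable M" for n using Z(2) by (rule borel_measurable_integrable)
  have "(\<lambda>m. prob (?B m)) \<longlonglongrightarrow> prob (\<Union>m. ?B m)"
    by (rule finite_Lim_measure_incseq) (use le_trans in \<open>fastforce simp: incseq_def\<close>)+
  moreover have "(\<Union>m. ?B m) = {\<omega> \<in> space M. \<exists>n. c \<le> Z n \<omega>}" by auto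
  moreover have "prob (?B m) \<le> K / c" for m
    using maximal_inequality_finite[OF Z nonneg sub, of c m] bound[of m] \<open>c > 0\<close>
    by (simp add: field_simps)
  ultimately show ?thesis by (intro LIMSEQ_le_const2) auto
qed

end

text \<open>The intersection lies in every \<open>B n\<close>, hence is null. One index per point is
  enough for the uses below, where \<open>B N\<close> is an event about the whole tail from
  \<open>N\<close> on.\<close>

lemma (in prob_space) AE_eventually_not_in:
  assumes B: "\<And>n. B n \<in> sets M" and lim: "(\<lambda>n. prob (B n)) \<longlonglongrightarrow> 0"
  shows "AE \<omega> in M. \<exists>n::nat. \<omega> \<notin> B n"
proof -
  have [measurable]: "(\<Inter>n. B n) \<in> sets M" using B by auto
  have "prob (\<Inter>n. B n) \<le> prob (B n)" for n
    by (rule finite_measure_mono) (auto simp: B)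
  then have "prob (\<Inter>n. B n) \<le> 0"
    using lim by (intro LIMSEQ_le_const) auto
  then have "AE \<omega> in M. \<omega> \<notin> (\<Inter>n. B n)"
    by (intro AE_not_in) (simp add: null_sets_def emeasure_eq_measure measure_le_0_iff)
  then show ?thesis by simp
qed

text \<open>A single good \<open>N\<close> controls all later indices at once, so one
  \<open>N\<close> per tolerance gives the Cauchy property. The tolerances
  \<open>1 / (k + 1)\<close> keep the null sets countable in number.\<close>

lemma (in prob_space) AE_Cauchy_of_tail_prob:
  fixes Y :: "nat \<Rightarrow> 'a \<Rightarrow> real"
  assumes Y[measurable]: "\<And>n. Y n \<in> borel_measurable M"
    and lim: "\<And>c. c > 0 \<Longrightarrow>
      (\<lambda>N. prob {\<omega> \<in> space M. \<exists>n. c \<le> \<bar>Y (N + n) \<omega> - Y N \<omega>\<bar>}) \<longlonglongrightarrow> 0"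
  shows "AE \<omega> in M. convergent (\<lambda>n. Y n \<omega>)"
proof -
  have "AE \<omega> in M. \<exists>N. \<forall>n. \<bar>Y (N + n) \<omega> - Y N \<omega>\<bar> < inverse (real (Suc k))" for k
  proof -
    have "AE \<omega> in M. \<exists>N. \<omega> \<notin> {\<omega> \<in> space M. \<exists>n. inverse (real (Suc k)) \<le> \<bar>Y (N + n) \<omega> - Y N \<omega>\<bar>}"
    proof (rule AE_eventually_not_in[OF _ lim])
      show "{\<omega> \<in> space M. \<exists>n. inverse (real (Suc k)) \<le> \<bar>Y (N + n) \<omega> - Y N \<omega>\<bar>} \<in> sets M" for N
        by measurable
    qed simp
    then show ?thesis using AE_space by eventually_elim (simp add: not_le)
  qed
  then have "AE \<omega> in M. \<forall>k. \<exists>N. \<forall>n. \<bar>Y (N + n) \<omega> - Y N \<omega>\<bar> < inverse (real (Suc k))"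
    by (simp add: AE_all_countable)
  then show ?thesis
  proof eventually_elim
    fix \<omega> assume H: "\<forall>k. \<exists>N. \<forall>n. \<bar>Y (N + n) \<omega> - Y N \<omega>\<bar> < inverse (real (Suc k))"
    have "\<exists>N. \<forall>n\<ge>N. dist (Y n \<omega>) (Y N \<omega>) < e" if "e > 0" for e
    proof -
      obtain k where k: "inverse (real (Suc k)) < e" using reals_Archimedean[OF \<open>e > 0\<close>] by blast
      obtain N where N: "\<And>n. \<bar>Y (N + n) \<omega> - Y N \<omega>\<bar> < inverse (real (Suc k))" using H by blast
      have "dist (Y n \<omega>) (Y N \<omega>) < e" if "n \<ge> N" for n
        using N[of "n - N"] k that by (simp add: dist_real_def)
      then show ?thesis by blast
    qed
    then have "Cauchy (\<lambda>n. Y n \<omega>)"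
      by (intro Cauchy_altdef2[THEN iffD2] allI impI)
    then show "convergent (\<lambda>n. Y n \<omega>)"
      by (rule Cauchy_convergent)
  qed
qed

section \<open>Convergence of bounded martingales and Hunt's lemma\<close>

lemma tendsto_null_of_nonneg_le:
  fixes f g :: "nat \<Rightarrow> real"
  assumes "\<And>n. 0 \<le> f n" "\<And>n. f n \<le> g n" "g \<longlonglongrightarrow> 0"
  shows "f \<longlonglongrightarrow> 0"
  using assms(3) by (rule Lim_null_comparison[rotated]) (simp add: assms(1,2))

text \<open>The bound is almost sure because conditional expectations are bounded only up to null
  sets. The class is closed under the arithmetic below and under \<open>real_cond_exp\<close>, so
  integrability conditions reduce to \<open>ae_bounded_intros\<close>.\<close>

definition ae_bounded :: "'a measure \<Rightarrow> ('a \<Rightarrow> real) \<Rightarrow> bool" where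
  "ae_bounded M f \<longleftrightarrow> f \<in> borel_measurable M \<and> (\<exists>K. AE \<omega> in M. \<bar>f \<omega>\<bar> \<le> K)"

lemma ae_boundedI: "f \<in> borel_measurable M \<Longrightarrow> AE \<omega> in M. \<bar>f \<omega>\<bar> \<le> K \<Longrightarrow> ae_bounded M f"
  unfolding ae_bounded_def by blast

lemma ae_bounded_measurable: "ae_bounded M f \<Longrightarrow> f \<in> borel_measurable M"
  unfolding ae_bounded_def by blast

lemma ae_boundedE:
  assumes "ae_bounded M f"
  obtains K where "AE \<omega> in M. \<bar>f \<omega>\<bar> \<le> K" "K \<ge> 0"
proof -
  obtain K where K: "AE \<omega> in M. \<bar>f \<omega>\<bar> \<le> K" using assms unfolding ae_bounded_def by blast
  have "AE \<omega> in M. \<bar>f \<omega>\<bar> \<le> max K 0" using K by eventually_elim simp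
  then show thesis by (rule that) simp
qed

named_theorems ae_bounded_intros

lemma ae_bounded_const [ae_bounded_intros]: "ae_bounded M (\<lambda>_. c)"
  by (rule ae_boundedI[of _ _ "\<bar>c\<bar>"]) auto

lemma ae_bounded_indicator [ae_bounded_intros]: "A \<in> sets M \<Longrightarrow> ae_bounded M (indicator A)"
  by (rule ae_boundedI[of _ _ 1]) auto

lemma ae_bounded_add [ae_bounded_intros]:
  assumes "ae_bounded M f" "ae_bounded M g"
  shows "ae_bounded M (\<lambda>\<omega>. f \<omega> + g \<omega>)"
proof -
  obtain K where K: "AE \<omega> in M. \<bar>f \<omega>\<bar> \<le> K" "K \<ge> 0" using assms(1) by (rule ae_boundedE)
  obtain L where L: "AE \<omega> in M. \<bar>g \<omega>\<bar> \<le> L" "L \<ge> 0" using assms(2) by (rule ae_boundedE)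
  from K(1) L(1) have "AE \<omega> in M. \<bar>f \<omega> + g \<omega>\<bar> \<le> K + L" by eventually_elim arith
  then show ?thesis
    by (rule ae_boundedI[rotated]) (intro borel_measurable_add ae_bounded_measurable assms)
qed

lemma ae_bounded_diff [ae_bounded_intros]:
  assumes "ae_bounded M f" "ae_bounded M g"
  shows "ae_bounded M (\<lambda>\<omega>. f \<omega> - g \<omega>)"
proof -
  obtain K where K: "AE \<omega> in M. \<bar>f \<omega>\<bar> \<le> K" "K \<ge> 0" using assms(1) by (rule ae_boundedE)
  obtain L where L: "AE \<omega> in M. \<bar>g \<omega>\<bar> \<le> L" "L \<ge> 0" using assms(2) by (rule ae_boundedE)
  from K(1) L(1) have "AE \<omega> in M. \<bar>f \<omega> - g \<omega>\<bar> \<le> K + L" by eventually_elim arith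
  then show ?thesis
    by (rule ae_boundedI[rotated]) (intro borel_measurable_diff ae_bounded_measurable assms)
qed

lemma ae_bounded_mult [ae_bounded_intros]:
  assumes "ae_bounded M f" "ae_bounded M g"
  shows "ae_bounded M (\<lambda>\<omega>. f \<omega> * g \<omega>)"
proof -
  obtain K where K: "AE \<omega> in M. \<bar>f \<omega>\<bar> \<le> K" "K \<ge> 0" using assms(1) by (rule ae_boundedE)
  obtain L where L: "AE \<omega> in M. \<bar>g \<omega>\<bar> \<le> L" "L \<ge> 0" using assms(2) by (rule ae_boundedE)
  have "AE \<omega> in M. \<bar>f \<omega> * g \<omega>\<bar> \<le> K * L"
    using K(1) L(1) by eventually_elim (simp add: abs_mult mult_mono K(2) L(2))
  then show ?thesis
    by (rule ae_boundedI[rotated]) (intro borel_measurable_times ae_bounded_measurable assms)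
qed

lemma ae_bounded_abs [ae_bounded_intros]:
  assumes "ae_bounded M f"
  shows "ae_bounded M (\<lambda>\<omega>. \<bar>f \<omega>\<bar>)"
proof -
  obtain K where K: "AE \<omega> in M. \<bar>f \<omega>\<bar> \<le> K" "K \<ge> 0" using assms by (rule ae_boundedE)
  from K(1) have "AE \<omega> in M. \<bar>\<bar>f \<omega>\<bar>\<bar> \<le> K" by simp
  then show ?thesis
    by (rule ae_boundedI[rotated]) (intro borel_measurable_abs ae_bounded_measurable assms)
qed

lemma ae_bounded_power2 [ae_bounded_intros]:
  "ae_bounded M f \<Longrightarrow> ae_bounded M (\<lambda>\<omega>. (f \<omega>)\<^sup>2)"
  unfolding power2_eq_square by (rule ae_bounded_mult)

lemma (in prob_space) integrable_ae_bounded: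
  assumes "ae_bounded M f"
  shows "integrable M f"
proof -
  obtain K where "AE \<omega> in M. \<bar>f \<omega>\<bar> \<le> K" "K \<ge> 0" using assms by (rule ae_boundedE)
  then show ?thesis
    by (intro integrable_const_bound[of f K] ae_bounded_measurable assms) simp
qed

section \<open>Bounded martingales and conditional expectations of null sequences\<close>

context filtered_prob_space
begin

lemma cond_exp_abs_bound:
  assumes f: "f \<in> borel_measurable M" and K: "AE \<omega> in M. \<bar>f \<omega>\<bar> \<le> K"
  shows "AE \<omega> in M. \<bar>real_cond_exp M (G n) f \<omega>\<bar> \<le> K"
proof -
  have int: "integrable M f" by (intro integrable_ae_bounded ae_boundedI[OF f K])
  have "AE \<omega> in M. f \<omega> \<le> K" using K by eventually_elim simp
  then have "AE \<omega> in M. real_cond_exp M (G n) f \<omega> \<le> K" by (rule cond.real_cond_exp_le_c[OF int])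
  moreover have "AE \<omega> in M. - K \<le> f \<omega>" using K by eventually_elim simp
  then have "AE \<omega> in M. - K \<le> real_cond_exp M (G n) f \<omega>" by (rule cond.real_cond_exp_ge_c[OF int])
  ultimately show ?thesis by eventually_elim simp
qed

lemma ae_bounded_cond_exp [ae_bounded_intros]:
  assumes "ae_bounded M f"
  shows "ae_bounded M (real_cond_exp M (G n) f)"
proof -
  obtain K where K: "AE \<omega> in M. \<bar>f \<omega>\<bar> \<le> K" "K \<ge> 0" using assms by (rule ae_boundedE)
  show ?thesis
    by (rule ae_boundedI[OF _ cond_exp_abs_bound[OF ae_bounded_measurable[OF assms] K(1)]]) simp
qed

text \<open>An L2 argument: increments are orthogonal, so the second moments \<open>a n\<close>
  increase, stay below \<open>C^2\<close> and converge to some \<open>L\<close>. The squared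
  increments after \<open>N\<close> form a submartingale with expectations at most
  \<open>L - a N\<close>, so the maximal inequality makes the oscillation after \<open>N\<close>
  small in probability.\<close>

lemma bounded_martingale_converges:
  assumes Y: "\<And>n. Y n \<in> borel_measurable (G n)"
    and bound: "\<And>n. AE \<omega> in M. \<bar>Y n \<omega>\<bar> \<le> C"
    and mart: "\<And>n. AE \<omega> in M. real_cond_exp M (G n) (Y (Suc n)) \<omega> = Y n \<omega>"
  shows "AE \<omega> in M. convergent (\<lambda>n. Y n \<omega>)"
proof -
  have YM[measurable]: "Y n \<in> borel_measurable M" for n
    using Y by (rule measurable_G_M)
  have Yb[ae_bounded_intros]: "ae_bounded M (Y n)" for n
    using YM bound by (rule ae_boundedI)
  have ortho: "(\<integral>\<omega>. W \<omega> * (Y (Suc n) \<omega> - Y n \<omega>) \<partial>M) = 0"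
    if W: "W \<in> borel_measurable (G n)" "ae_bounded M W" for W n
  proof -
    have WY: "integrable M (\<lambda>\<omega>. W \<omega> * Y k \<omega>)" for k
      by (intro integrable_ae_bounded ae_bounded_intros W)
    have "(\<integral>\<omega>. W \<omega> * Y (Suc n) \<omega> \<partial>M) = (\<integral>\<omega>. W \<omega> * real_cond_exp M (G n) (Y (Suc n)) \<omega> \<partial>M)"
      by (intro cond.real_cond_exp_intg(2)[symmetric] WY W YM)
    also have "\<dots> = (\<integral>\<omega>. W \<omega> * Y n \<omega> \<partial>M)"
    proof (rule integral_cong_AE)
      show "AE \<omega> in M. W \<omega> * real_cond_exp M (G n) (Y (Suc n)) \<omega> = W \<omega> * Y n \<omega>"
        using mart[of n] by eventually_elim simp
    qed (intro borel_measurable_times borel_measurable_cond_exp2 YM ae_bounded_measurable W)+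
    finally show ?thesis using WY by (simp add: right_diff_distrib)
  qed
  have ortho': "(\<integral>\<omega>. Y N \<omega> * (Y (N + m) \<omega> - Y N \<omega>) \<partial>M) = 0" for N m
  proof (induction m)
    case (Suc m)
    have "(\<integral>\<omega>. Y N \<omega> * (Y (N + Suc m) \<omega> - Y N \<omega>) \<partial>M)
      = (\<integral>\<omega>. Y N \<omega> * (Y (Suc (N + m)) \<omega> - Y (N + m) \<omega>) + Y N \<omega> * (Y (N + m) \<omega> - Y N \<omega>) \<partial>M)"
      by (simp add: algebra_simps)
    also have "\<dots> = (\<integral>\<omega>. Y N \<omega> * (Y (Suc (N + m)) \<omega> - Y (N + m) \<omega>) \<partial>M)
        + (\<integral>\<omega>. Y N \<omega> * (Y (N + m) \<omega> - Y N \<omega>) \<partial>M)"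
      by (intro Bochner_Integration.integral_add integrable_ae_bounded ae_bounded_intros)
    also have "\<dots> = 0"
      using ortho[of "Y N" "N + m"] measurable_G_mono[OF _ Y, of N "N + m"] Suc Yb by simp
    finally show ?case .
  qed simp
  define a where "a n = (\<integral>\<omega>. (Y n \<omega>)\<^sup>2 \<partial>M)" for n
  have incr: "(\<integral>\<omega>. (Y (N + m) \<omega> - Y N \<omega>)\<^sup>2 \<partial>M) = a (N + m) - a N" for N m
  proof -
    \<comment> \<open>The square of x - y is rewritten as x^2 - y^2 - 2 y (x - y), whose last term
      integrates to 0 by \<open>ortho'\<close>.\<close>
    have "(\<integral>\<omega>. (Y (N + m) \<omega> - Y N \<omega>)\<^sup>2 \<partial>M) =
      (\<integral>\<omega>. (Y (N + m) \<omega>)\<^sup>2 - (Y N \<omega>)\<^sup>2 - 2 * (Y N \<omega> * (Y (N + m) \<omega> - Y N \<omega>)) \<partial>M)"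
      by (intro Bochner_Integration.integral_cong) (auto simp: power2_eq_square algebra_simps)
    also have "\<dots> = (\<integral>\<omega>. (Y (N + m) \<omega>)\<^sup>2 - (Y N \<omega>)\<^sup>2 \<partial>M)
        - (\<integral>\<omega>. 2 * (Y N \<omega> * (Y (N + m) \<omega> - Y N \<omega>)) \<partial>M)"
      by (intro Bochner_Integration.integral_diff integrable_ae_bounded ae_bounded_intros)
    also have "(\<integral>\<omega>. (Y (N + m) \<omega>)\<^sup>2 - (Y N \<omega>)\<^sup>2 \<partial>M) = a (N + m) - a N"
      unfolding a_def
      by (intro Bochner_Integration.integral_diff integrable_ae_bounded ae_bounded_intros)
    finally show ?thesis by (simp add: ortho')
  qed
  have a_le: "a N \<le> a (N + m)" for N m
    
  proof -
    have "0 \<le> (\<integral>\<omega>. (Y (N + m) \<omega> - Y N \<omega>)\<^sup>2 \<partial>M)" by (rule integral_nonneg_AE) simp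
    then show ?thesis by (simp add: incr)
  qed
  have "incseq a"
    unfolding incseq_Suc_iff using a_le[of _ 1] by simp
  moreover have "a n \<le> C\<^sup>2" for n
  proof -
    have "AE \<omega> in M. (Y n \<omega>)\<^sup>2 \<le> C\<^sup>2"
      using bound[of n] by eventually_elim (simp add: abs_le_square_iff[symmetric])
    then have "a n \<le> (\<integral>\<omega>. C\<^sup>2 \<partial>M)"
      unfolding a_def by (intro integral_mono_AE integrable_ae_bounded ae_bounded_intros)
    then show ?thesis by (simp add: prob_space)
  qed
  ultimately obtain L where L: "a \<longlonglongrightarrow> L" "\<And>n. a n \<le> L"
    by (metis incseq_convergent)
  show ?thesis
  proof (rule AE_Cauchy_of_tail_prob[OF YM])
    fix c :: real assume "c > 0"
    have "prob {\<omega> \<in> space M. \<exists>n. c \<le> \<bar>Y (N + n) \<omega> - Y N \<omega>\<bar>} \<le> (L - a N) / c\<^sup>2" for N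
    proof -
      interpret shift: filtered_prob_space M "\<lambda>n. G (N + n)" by (rule shifted_filtration)
      let ?Z = "\<lambda>n \<omega>. (Y (N + n) \<omega> - Y N \<omega>)\<^sup>2"
      have meas: "Y N \<in> borel_measurable (G (N + n))" for n
        by (rule measurable_G_mono[OF _ Y]) simp
      have "prob {\<omega> \<in> space M. \<exists>n. c\<^sup>2 \<le> ?Z n \<omega>} \<le> (L - a N) / c\<^sup>2"
      proof (rule shift.maximal_inequality)
        show "?Z n \<in> borel_measurable (G (N + n))" for n
          by (intro borel_measurable_power borel_measurable_diff Y meas)
        show "integrable M (?Z n)" for n
          by (intro integrable_ae_bounded ae_bounded_intros)
        show "(\<integral>\<omega>. ?Z n \<omega> \<partial>M) \<le> L - a N" for n
          unfolding incr using L(2) by simp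
        show "(\<integral>\<omega>. indicator A \<omega> * ?Z n \<omega> \<partial>M) \<le> (\<integral>\<omega>. indicator A \<omega> * ?Z (Suc n) \<omega> \<partial>M)"
          if A: "A \<in> sets (G (N + n))" for n A
        proof -
          \<comment> \<open>\<open>?W\<close> is known at time \<open>N + n\<close>, so its product
            with the next increment has mean 0. Adding that product supplies the cross term of the
            next square; only the squared increment, which is nonnegative, is dropped.\<close>
          let ?W = "\<lambda>\<omega>. 2 * (indicator A \<omega> * (Y (N + n) \<omega> - Y N \<omega>))"
          have AM: "A \<in> sets M" using A sets_G_subset by blast
          have "(\<integral>\<omega>. indicator A \<omega> * ?Z n \<omega> \<partial>M) =
            (\<integral>\<omega>. indicator A \<omega> * ?Z n \<omega> \<partial>M) + (\<integral>\<omega>. ?W \<omega> * (Y (Suc (N + n)) \<omega> - Y (N + n) \<omega>) \<partial>M)"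
            by (subst ortho) (intro borel_measurable_times borel_measurable_const borel_measurable_indicator
                borel_measurable_diff Y meas A ae_bounded_intros AM | simp)+
          also have "\<dots> = (\<integral>\<omega>. indicator A \<omega> * ?Z n \<omega> + ?W \<omega> * (Y (Suc (N + n)) \<omega> - Y (N + n) \<omega>) \<partial>M)"
            by (intro Bochner_Integration.integral_add[symmetric] integrable_ae_bounded ae_bounded_intros AM)
          also have "\<dots> \<le> (\<integral>\<omega>. indicator A \<omega> * ?Z (Suc n) \<omega> \<partial>M)"
          proof (rule integral_mono)
            fix \<omega>
            have "(q - p)\<^sup>2 + 2 * (q - p) * (r - q) \<le> (r - p)\<^sup>2" for p q r :: real
            proof -
              have "(r - p)\<^sup>2 = (q - p)\<^sup>2 + 2 * (q - p) * (r - q) + (r - q)\<^sup>2"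
                by (simp add: power2_eq_square algebra_simps)
              then show ?thesis using zero_le_power2[of "r - q"] by linarith
            qed
            from this[of "Y (N + n) \<omega>" "Y N \<omega>" "Y (Suc (N + n)) \<omega>"]
            show "indicator A \<omega> * ?Z n \<omega> + ?W \<omega> * (Y (Suc (N + n)) \<omega> - Y (N + n) \<omega>)
                \<le> indicator A \<omega> * ?Z (Suc n) \<omega>"
              by (cases "\<omega> \<in> A") simp_all
          qed (intro integrable_ae_bounded ae_bounded_intros AM)+
          finally show ?thesis .
        qed
        show "c\<^sup>2 > 0" using \<open>c > 0\<close> by simp
      qed simp
      moreover have "c\<^sup>2 \<le> x\<^sup>2 \<longleftrightarrow> c \<le> \<bar>x\<bar>" for x :: real
        using \<open>c > 0\<close> by (simp add: abs_le_square_iff[symmetric])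
      ultimately show ?thesis by simp
    qed
    moreover have "(\<lambda>N. (L - a N) / c\<^sup>2) \<longlonglongrightarrow> 0"
      using tendsto_divide[OF tendsto_diff[OF tendsto_const L(1), of L] tendsto_const, of "c\<^sup>2"] \<open>c > 0\<close>
      by simp
    ultimately show "(\<lambda>N. prob {\<omega> \<in> space M. \<exists>n. c \<le> \<bar>Y (N + n) \<omega> - Y N \<omega>\<bar>}) \<longlonglongrightarrow> 0"
      by (rule tendsto_null_of_nonneg_le[OF measure_nonneg])
  qed
qed

lemma cond_exp_abs_le:
  assumes "ae_bounded M f"
  shows "AE \<omega> in M. \<bar>real_cond_exp M (G n) f \<omega>\<bar> \<le> real_cond_exp M (G n) (\<lambda>\<omega>. \<bar>f \<omega>\<bar>) \<omega>"
proof -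
  have f: "integrable M f" and f': "integrable M (\<lambda>\<omega>. \<bar>f \<omega>\<bar>)" and f'': "integrable M (\<lambda>\<omega>. -1 * f \<omega>)"
    by (intro integrable_ae_bounded ae_bounded_intros assms)+
  have "AE \<omega> in M. real_cond_exp M (G n) f \<omega> \<le> real_cond_exp M (G n) (\<lambda>\<omega>. \<bar>f \<omega>\<bar>) \<omega>"
    by (intro cond.real_cond_exp_mono f f') auto
  moreover have "AE \<omega> in M. real_cond_exp M (G n) (\<lambda>\<omega>. -1 * f \<omega>) \<omega> \<le> real_cond_exp M (G n) (\<lambda>\<omega>. \<bar>f \<omega>\<bar>) \<omega>"
    by (intro cond.real_cond_exp_mono f'' f') auto
  moreover have "AE \<omega> in M. real_cond_exp M (G n) (\<lambda>\<omega>. -1 * f \<omega>) \<omega> = -1 * real_cond_exp M (G n) f \<omega>"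
    by (intro cond.real_cond_exp_cmult f)
  ultimately show ?thesis by eventually_elim auto
qed

text \<open>Hunt's lemma for a null sequence: Doob's inequality, applied to the martingale
  $E[\sup_{k \ge N} |D_k| \mid \mathcal{G}_n]$, replaces the martingale convergence theorem.\<close>

lemma cond_exp_null_sequence:
  fixes D :: "nat \<Rightarrow> 'a \<Rightarrow> real"
  assumes D[measurable]: "\<And>n. D n \<in> borel_measurable M"
    and bound: "\<And>n. AE \<omega> in M. \<bar>D n \<omega>\<bar> \<le> C"
    and lim: "AE \<omega> in M. (\<lambda>n. D n \<omega>) \<longlonglongrightarrow> 0"
  shows "AE \<omega> in M. (\<lambda>n. real_cond_exp M (G n) (D n) \<omega>) \<longlonglongrightarrow> 0"
proof -
  \<comment> \<open>Truncation at \<open>C\<close> changes nothing almost surely, but bounds the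
    family at every point, as \<open>borel_measurable_cSUP\<close> and \<open>cSUP_upper\<close>
    require.\<close>
  define S where "S N \<omega> = (SUP k. min \<bar>D (N + k) \<omega>\<bar> C)" for N \<omega>
  have bdd: "bdd_above (range (\<lambda>k. min \<bar>D (N + k) \<omega>\<bar> C))" for N \<omega>
    by (rule bdd_aboveI[of _ C]) auto
  have SM[measurable]: "S N \<in> borel_measurable M" for N
    unfolding S_def[abs_def] by (rule borel_measurable_cSUP) (auto intro: bdd)
  have S_upper: "min \<bar>D (N + k) \<omega>\<bar> C \<le> S N \<omega>" for N k \<omega>
    unfolding S_def by (rule cSUP_upper[OF _ bdd]) simp
  have bound': "AE \<omega> in M. \<forall>n. \<bar>D n \<omega>\<bar> \<le> C" using bound by (simp add: AE_all_countable)
  have S_bound: "AE \<omega> in M. \<forall>N. 0 \<le> S N \<omega> \<and> S N \<omega> \<le> C"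
    using bound'
  proof eventually_elim
    fix \<omega> assume H: "\<forall>n. \<bar>D n \<omega>\<bar> \<le> C"
    then have "0 \<le> C" by (meson abs_ge_zero order_trans)
    moreover have "0 \<le> min \<bar>D (N + 0) \<omega>\<bar> C" for N using \<open>0 \<le> C\<close> by simp
    then have "0 \<le> S N \<omega>" for N using S_upper[of N 0 \<omega>] by (meson order_trans)
    ultimately show "\<forall>N. 0 \<le> S N \<omega> \<and> S N \<omega> \<le> C"
      unfolding S_def by (auto intro!: cSUP_least)
  qed
  have S_lim: "AE \<omega> in M. (\<lambda>N. S N \<omega>) \<longlonglongrightarrow> 0"
    using lim S_bound
  proof eventually_elim
    fix \<omega> assume l: "(\<lambda>n. D n \<omega>) \<longlonglongrightarrow> 0" and b: "\<forall>N. 0 \<le> S N \<omega> \<and> S N \<omega> \<le> C"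
    show "(\<lambda>N. S N \<omega>) \<longlonglongrightarrow> 0"
    proof (rule LIMSEQ_I)
      fix r :: real assume "r > 0"
      then obtain N0 where N0: "\<And>n. n \<ge> N0 \<Longrightarrow> \<bar>D n \<omega>\<bar> < r / 2"
        using LIMSEQ_D[OF l, of "r / 2"] by auto
      have "S N \<omega> \<le> r / 2" if "N \<ge> N0" for N
        unfolding S_def
      proof (rule cSUP_least)
        fix k show "min \<bar>D (N + k) \<omega>\<bar> C \<le> r / 2"
          using N0[of "N + k"] that by (simp add: min_def)
      qed simp
      then show "\<exists>no. \<forall>n\<ge>no. norm (S n \<omega> - 0) < r"
        using b \<open>r > 0\<close> by (intro exI[of _ N0]) (force simp: field_simps)
    qed
  qed
  have Sb[ae_bounded_intros]: "ae_bounded M (S N)" for N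
    by (rule ae_boundedI[OF SM, of _ C]) (use S_bound in eventually_elim, auto)
  have Db[ae_bounded_intros]: "ae_bounded M (D N)" for N
    by (rule ae_boundedI[OF D bound])
  have ES: "(\<lambda>N. \<integral>\<omega>. S N \<omega> \<partial>M) \<longlonglongrightarrow> (\<integral>\<omega>. 0 \<partial>M)"
  proof (rule integral_dominated_convergence[where w = "\<lambda>_. C"])
    show "AE \<omega> in M. norm (S N \<omega>) \<le> C" for N
      using S_bound by eventually_elim auto
  qed (auto intro: S_lim)
  let ?T = "\<lambda>N n. real_cond_exp M (G (N + n)) (S N)"
  have dom: "AE \<omega> in M. \<forall>N n. \<bar>real_cond_exp M (G (N + n)) (D (N + n)) \<omega>\<bar> \<le> ?T N n \<omega>"
  proof -
    have "AE \<omega> in M. \<bar>real_cond_exp M (G (N + n)) (D (N + n)) \<omega>\<bar> \<le> ?T N n \<omega>" for N n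
    proof -
      have "AE \<omega> in M. \<bar>D (N + n) \<omega>\<bar> \<le> S N \<omega>"
        using bound[of "N + n"]
      proof eventually_elim
        fix \<omega> assume "\<bar>D (N + n) \<omega>\<bar> \<le> C"
        then show "\<bar>D (N + n) \<omega>\<bar> \<le> S N \<omega>"
          using S_upper[of N n \<omega>] by (simp add: min_absorb1)
      qed
      then have "AE \<omega> in M. real_cond_exp M (G (N + n)) (\<lambda>\<omega>. \<bar>D (N + n) \<omega>\<bar>) \<omega> \<le> ?T N n \<omega>"
        by (intro cond.real_cond_exp_mono integrable_ae_bounded ae_bounded_intros)
      moreover have "AE \<omega> in M. \<bar>real_cond_exp M (G (N + n)) (D (N + n)) \<omega>\<bar>
          \<le> real_cond_exp M (G (N + n)) (\<lambda>\<omega>. \<bar>D (N + n) \<omega>\<bar>) \<omega>"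
        by (intro cond_exp_abs_le ae_bounded_intros)
      ultimately show ?thesis by eventually_elim (rule order_trans)
    qed
    then show ?thesis by (simp add: AE_all_countable)
  qed
  have small: "AE \<omega> in M. \<exists>N. \<forall>n. ?T N n \<omega> < c" if "c > 0" for c
  proof -
    have meas: "{\<omega> \<in> space M. \<exists>n. c \<le> ?T N n \<omega>} \<in> sets M" for N by measurable
    \<comment> \<open>For fixed \<open>N\<close>, \<open>?T N n\<close> is a martingale in
      \<open>n\<close> for the filtration restarted at \<open>N\<close>. Its expectation is that of
      \<open>S N\<close>, which tends to 0 by \<open>ES\<close>.\<close>
    have le: "prob {\<omega> \<in> space M. \<exists>n. c \<le> ?T N n \<omega>} \<le> (\<integral>\<omega>. S N \<omega> \<partial>M) / c" for N
    proof -
      interpret shift: filtered_prob_space M "\<lambda>n. G (N + n)" by (rule shifted_filtration)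
      show ?thesis
      proof (rule shift.maximal_inequality)
        show "?T N n \<in> borel_measurable (G (N + n))" for n by (rule borel_measurable_cond_exp)
        show "integrable M (?T N n)" for n by (intro integrable_ae_bounded ae_bounded_intros)
        show "AE \<omega> in M. 0 \<le> ?T N n \<omega>" for n
          by (rule cond.real_cond_exp_pos) (use S_bound in eventually_elim, auto)
        show "(\<integral>\<omega>. ?T N n \<omega> \<partial>M) \<le> (\<integral>\<omega>. S N \<omega> \<partial>M)" for n
          by (simp add: cond.real_cond_exp_int integrable_ae_bounded Sb)
        show "(\<integral>\<omega>. indicator A \<omega> * ?T N n \<omega> \<partial>M) \<le> (\<integral>\<omega>. indicator A \<omega> * ?T N (Suc n) \<omega> \<partial>M)"
          if A: "A \<in> sets (G (N + n))" for n A
        proof -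
          have A': "A \<in> sets (G (N + Suc n))" using A G_mono[of "N + n" "N + Suc n"] by auto
          have AM: "A \<in> sets M" using A sets_G_subset by blast
          have i: "integrable M (\<lambda>\<omega>. indicator A \<omega> * S N \<omega>)"
            by (intro integrable_ae_bounded ae_bounded_intros AM)
          show ?thesis
            using cond.real_cond_exp_intg(2)[OF i borel_measurable_indicator[OF A] SM]
              cond.real_cond_exp_intg(2)[OF i borel_measurable_indicator[OF A'] SM] by simp
        qed
      qed (use \<open>c > 0\<close> in auto)
    qed
    have "(\<lambda>N. (\<integral>\<omega>. S N \<omega> \<partial>M) / c) \<longlonglongrightarrow> 0"
      using tendsto_divide[OF ES tendsto_const, of c] \<open>c > 0\<close> by simp
    then have "(\<lambda>N. prob {\<omega> \<in> space M. \<exists>n. c \<le> ?T N n \<omega>}) \<longlonglongrightarrow> 0"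
      by (rule tendsto_null_of_nonneg_le[OF measure_nonneg le])
    then have "AE \<omega> in M. \<exists>N. \<omega> \<notin> {\<omega> \<in> space M. \<exists>n. c \<le> ?T N n \<omega>}"
      by (rule AE_eventually_not_in[OF meas])
    then show ?thesis using AE_space by eventually_elim (simp add: not_le)
  qed
  have "AE \<omega> in M. \<forall>k. \<exists>N. \<forall>n. ?T N n \<omega> < inverse (real (Suc k))"
    unfolding AE_all_countable by (intro allI small) simp
  with dom show ?thesis
  proof eventually_elim
    fix \<omega>
    assume d: "\<forall>N n. \<bar>real_cond_exp M (G (N + n)) (D (N + n)) \<omega>\<bar> \<le> ?T N n \<omega>"
      and s: "\<forall>k. \<exists>N. \<forall>n. ?T N n \<omega> < inverse (real (Suc k))"
    show "(\<lambda>n. real_cond_exp M (G n) (D n) \<omega>) \<longlonglongrightarrow> 0"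
    proof (rule LIMSEQ_I)
      fix r :: real assume "r > 0"
      obtain k where k: "inverse (real (Suc k)) < r" using reals_Archimedean[OF \<open>r > 0\<close>] by blast
      obtain N where N: "\<And>n. ?T N n \<omega> < inverse (real (Suc k))" using s by blast
      have "\<bar>real_cond_exp M (G n) (D n) \<omega>\<bar> < r" if "n \<ge> N" for n
        using d[rule_format, of N "n - N"] N[of "n - N"] k that by simp
      then show "\<exists>no. \<forall>n\<ge>no. norm (real_cond_exp M (G n) (D n) \<omega> - 0) < r" by auto
    qed
  qed
qed

end

section \<open>A portmanteau theorem for almost surely positive functionals\<close>

text \<open>Bounded at every point: the same function is integrated against all the measures
  \<open>\<mu> \<omega>\<close>, which need not share null sets.\<close>

definition bounded_borel :: "('s::topological_space \<Rightarrow> real) \<Rightarrow> bool" where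
  "bounded_borel f \<longleftrightarrow> f \<in> borel_measurable borel \<and> bounded (range f)"

lemma bounded_borel_const: "bounded_borel (\<lambda>_. c)"
  by (auto simp: bounded_borel_def)

lemma bounded_borel_indicator: "A \<in> sets borel \<Longrightarrow> bounded_borel (indicator A)"
  by (auto simp: bounded_borel_def bounded_iff intro!: exI[of _ 1])

lemma bounded_borel_add: "bounded_borel f \<Longrightarrow> bounded_borel g \<Longrightarrow> bounded_borel (\<lambda>x. f x + g x)"
  by (auto simp: bounded_borel_def intro: bounded_plus_comp)

lemma bounded_borel_cmult:
  assumes "bounded_borel f"
  shows "bounded_borel (\<lambda>x. c * f x)"
proof -
  have "bounded ((\<lambda>y. c *\<^sub>R y) ` range f)"
    using assms by (intro bounded_scaling) (simp add: bounded_borel_def)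
  then show ?thesis
    using assms by (auto simp: bounded_borel_def image_image)
qed

lemma bounded_borel_bcontfun:
  fixes f :: "'s::topological_space \<Rightarrow> real"
  shows "f \<in> bcontfun \<Longrightarrow> bounded_borel f"
  by (auto simp: bounded_borel_def bcontfun_def intro: borel_measurable_continuous_onI)

lemma integrable_bounded_borel:
  fixes M :: "'s::topological_space measure"
  assumes "prob_space M" "bounded_borel f" "sets M = sets borel"
  shows "integrable M f"
proof -
  interpret prob_space M by fact
  obtain K where K: "\<And>x. \<bar>f x\<bar> \<le> K"
    using assms(2) by (auto simp: bounded_borel_def bounded_iff)
  have "f \<in> borel_measurable M"
    using assms(2) by (simp add: bounded_borel_def measurable_cong_sets[OF assms(3) refl])
  then show ?thesis
    by (intro integrable_const_bound[of f K]) (simp_all add: K)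
qed

text \<open>The sum counts the integers among 1, ..., k strictly below \<open>s\<close>. The
  truncation at \<open>Suc k\<close> in the second bound lets the induction close; for
  \<open>s\<close> at most \<open>k\<close> both truncations disappear and the count is within 1 of
  \<open>s\<close>.\<close>

lemma staircase_bounds:
  fixes s :: real
  assumes "s \<ge> 0"
  shows "(\<Sum>j<k. indicator {real (Suc j)<..} s) \<le> min s (real k) \<and>
    min s (real (Suc k)) \<le> (\<Sum>j<k. indicator {real (Suc j)<..} s) + 1"
proof (induction k)
  case 0
  show ?case using assms by simp
next
  case (Suc k)
  then show ?case
    by (cases "s > real (Suc k)") (auto simp: min_def split: if_splits)
qed

text \<open>The portmanteau argument for functionals that are linear and monotone only up to null
  sets. It replaces regular conditional distributions.\<close>

locale almost_surely_positive_functionals = prob_space +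
  fixes L :: "nat \<Rightarrow> ('s::topological_space \<Rightarrow> real) \<Rightarrow> 'a \<Rightarrow> real"
    and \<mu> :: "'a \<Rightarrow> 's measure" and \<R> :: "'s set set"
  assumes L_add: "\<And>n f g. bounded_borel f \<Longrightarrow> bounded_borel g \<Longrightarrow>
      AE \<omega> in M. L n (\<lambda>x. f x + g x) \<omega> = L n f \<omega> + L n g \<omega>"
    and L_cmult: "\<And>n f c. bounded_borel f \<Longrightarrow> AE \<omega> in M. L n (\<lambda>x. c * f x) \<omega> = c * L n f \<omega>"
    and L_mono: "\<And>n f g. bounded_borel f \<Longrightarrow> bounded_borel g \<Longrightarrow> (\<And>x. f x \<le> g x) \<Longrightarrow>
      AE \<omega> in M. L n f \<omega> \<le> L n g \<omega>"
    and prob_\<mu>: "\<And>\<omega>. \<omega> \<in> space M \<Longrightarrow> prob_space (\<mu> \<omega>)"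
    and sets_\<mu>: "\<And>\<omega>. \<omega> \<in> space M \<Longrightarrow> sets (\<mu> \<omega>) = sets borel"
    and \<R>_borel: "\<And>R. R \<in> \<R> \<Longrightarrow> R \<in> sets borel"
    and \<R>_UNIV: "UNIV \<in> \<R>"
    and \<R>_Int: "\<And>R S. R \<in> \<R> \<Longrightarrow> S \<in> \<R> \<Longrightarrow> R \<inter> S \<in> \<R>"
    and \<R>_open: "\<And>U. open U \<Longrightarrow> \<exists>R::nat \<Rightarrow> 's set. range R \<subseteq> \<R> \<and> U = (\<Union>i. R i)"
    and conv_\<R>: "\<And>R. R \<in> \<R> \<Longrightarrow>
      AE \<omega> in M. (\<lambda>n. L n (indicator R) \<omega>) \<longlonglongrightarrow> measure (\<mu> \<omega>) R"
begin

text \<open>The exceptional null set may depend on \<open>f\<close>. Bundling with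
  \<open>bounded_borel\<close> makes the predicate stable under linear combinations, since
  \<open>L_add\<close> and \<open>L_cmult\<close> ask for it.\<close>

definition convergent_on :: "('s \<Rightarrow> real) \<Rightarrow> bool" where
  "convergent_on f \<longleftrightarrow> bounded_borel f \<and>
    (AE \<omega> in M. (\<lambda>n. L n f \<omega>) \<longlonglongrightarrow> (\<integral>x. f x \<partial>\<mu> \<omega>))"

lemma integrable_\<mu>: "\<omega> \<in> space M \<Longrightarrow> bounded_borel f \<Longrightarrow> integrable (\<mu> \<omega>) f"
  by (rule integrable_bounded_borel[OF prob_\<mu> _ sets_\<mu>])

lemma integral_indicator_\<mu>: "\<omega> \<in> space M \<Longrightarrow> (\<integral>x. indicator A x \<partial>\<mu> \<omega>) = measure (\<mu> \<omega>) A"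
  using sets_eq_imp_space_eq[OF sets_\<mu>, of \<omega>] by simp

lemma convergent_on_add:
  assumes "convergent_on f" "convergent_on g"
  shows "convergent_on (\<lambda>x. f x + g x)"
proof -
  have fg: "bounded_borel f" "bounded_borel g" using assms by (auto simp: convergent_on_def)
  have "AE \<omega> in M. \<forall>n. L n (\<lambda>x. f x + g x) \<omega> = L n f \<omega> + L n g \<omega>"
    unfolding AE_all_countable using L_add[OF fg] by blast
  moreover have "AE \<omega> in M. (\<lambda>n. L n f \<omega>) \<longlonglongrightarrow> (\<integral>x. f x \<partial>\<mu> \<omega>)"
    "AE \<omega> in M. (\<lambda>n. L n g \<omega>) \<longlonglongrightarrow> (\<integral>x. g x \<partial>\<mu> \<omega>)"
    using assms by (auto simp: convergent_on_def)
  ultimately have "AE \<omega> in M. (\<lambda>n. L n (\<lambda>x. f x + g x) \<omega>) \<longlonglongrightarrow> (\<integral>x. f x + g x \<partial>\<mu> \<omega>)"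
    using AE_space
    by eventually_elim (simp add: Bochner_Integration.integral_add integrable_\<mu> fg tendsto_add)
  then show ?thesis using bounded_borel_add[OF fg] by (simp add: convergent_on_def)
qed

lemma convergent_on_cmult:
  assumes "convergent_on f"
  shows "convergent_on (\<lambda>x. c * f x)"
proof -
  have f: "bounded_borel f" using assms by (auto simp: convergent_on_def)
  have "AE \<omega> in M. \<forall>n. L n (\<lambda>x. c * f x) \<omega> = c * L n f \<omega>"
    unfolding AE_all_countable using L_cmult[OF f] by blast
  moreover have "AE \<omega> in M. (\<lambda>n. L n f \<omega>) \<longlonglongrightarrow> (\<integral>x. f x \<partial>\<mu> \<omega>)"
    using assms by (auto simp: convergent_on_def)
  ultimately have "AE \<omega> in M. (\<lambda>n. L n (\<lambda>x. c * f x) \<omega>) \<longlonglongrightarrow> (\<integral>x. c * f x \<partial>\<mu> \<omega>)"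
    by eventually_elim (simp add: tendsto_mult_left)
  then show ?thesis using bounded_borel_cmult[OF f] by (simp add: convergent_on_def)
qed

lemma convergent_on_\<R>:
  assumes "R \<in> \<R>"
  shows "convergent_on (indicator R)"
proof -
  have "AE \<omega> in M. (\<lambda>n. L n (indicator R) \<omega>) \<longlonglongrightarrow> (\<integral>x. indicator R x \<partial>\<mu> \<omega>)"
    using conv_\<R>[OF assms] AE_space by eventually_elim (simp only: integral_indicator_\<mu>)
  then show ?thesis
    using bounded_borel_indicator[OF \<R>_borel[OF assms]] by (simp add: convergent_on_def)
qed

lemma convergent_on_sum:
  assumes "\<And>i. convergent_on (f i)"
  shows "convergent_on (\<lambda>x. \<Sum>i<m::nat. f i x)"
proof (induction m)
  case 0
  show ?case using convergent_on_cmult[OF convergent_on_\<R>[OF \<R>_UNIV], of 0] by simp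
next
  case (Suc m)
  then show ?case by (simp add: convergent_on_add assms)
qed

text \<open>Inclusion-exclusion, one set at a time. The factor \<open>S\<close> is the
  generalisation that the induction needs: the overlap of the earlier union with \<open>R m\<close>
  is again such a union, cut down by \<open>S \<inter> R m\<close> from \<open>\<R>\<close>.\<close>

lemma convergent_on_Int_UN:
  assumes "\<And>i. R i \<in> \<R>" "S \<in> \<R>"
  shows "convergent_on (indicator (S \<inter> (\<Union>i<m::nat. R i)))"
  using assms(2)
proof (induction m arbitrary: S)
  case 0
  then show ?case using convergent_on_cmult[OF convergent_on_\<R>[OF \<R>_UNIV], of 0] by simp
next
  case (Suc m)
  have "convergent_on (\<lambda>x. (indicator (S \<inter> (\<Union>i<m. R i)) x + indicator (S \<inter> R m) x) +
      (-1) * indicator ((S \<inter> R m) \<inter> (\<Union>i<m. R i)) x)"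
    by (rule convergent_on_add, rule convergent_on_add, rule Suc.IH, fact, rule convergent_on_\<R>,
        rule \<R>_Int, fact, rule assms(1), rule convergent_on_cmult, rule Suc.IH, rule \<R>_Int, fact, rule assms(1))
  moreover have "(\<lambda>x. (indicator (S \<inter> (\<Union>i<m. R i)) x + indicator (S \<inter> R m) x) +
      (-1) * indicator ((S \<inter> R m) \<inter> (\<Union>i<m. R i)) x) =
      (indicator (S \<inter> (\<Union>i<Suc m. R i)) :: 's \<Rightarrow> real)"
    by (auto simp: fun_eq_iff lessThan_Suc split: split_indicator)
  ultimately show ?case by simp
qed

text \<open>The liminf half of the portmanteau theorem. Superlevel sets of \<open>g\<close> are
  open; staircases built from finite unions of sets of \<open>\<R>\<close> lie below
  \<open>g\<close>, and \<open>L n\<close> converges on them. The level \<open>c\<close> may be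
  quantified inside the almost sure statement because all null sets come from the countable family
  of staircases.\<close>

lemma eventually_gt_of_continuous:
  fixes g :: "'s \<Rightarrow> real"
  assumes g: "continuous_on UNIV g" and range: "\<And>x. 0 \<le> g x" "\<And>x. g x \<le> 1"
  shows "AE \<omega> in M. \<forall>c < (\<integral>x. g x \<partial>\<mu> \<omega>). eventually (\<lambda>n. c < L n g \<omega>) sequentially"
proof -
  have gb: "bounded_borel g"
    using range by (auto simp: bounded_borel_def bounded_iff abs_le_iff
        intro!: borel_measurable_continuous_onI[OF g] exI[of _ 1] order_trans[OF _ range(1)])
  define U where "U m j = {x. real (Suc j) < real m * g x}" for m j :: nat
  have "open (U m j)" for m j
    unfolding U_def by (intro open_Collect_less continuous_intros g)
  then have "\<forall>m j. \<exists>R::nat \<Rightarrow> 's set. range R \<subseteq> \<R> \<and> U m j = (\<Union>i. R i)"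
    using \<R>_open by blast
  then obtain R :: "nat \<Rightarrow> nat \<Rightarrow> nat \<Rightarrow> 's set"
    where R: "\<And>m j. range (R m j) \<subseteq> \<R>" "\<And>m j. U m j = (\<Union>i. R m j i)"
    by metis
  have U_borel: "U m j \<in> sets borel" for m j
    using \<open>open (U m j)\<close> by simp
  define V where "V m j k = (\<Union>i<k. R m j i)" for m j k
  \<comment> \<open>Each superlevel set \<open>U m j\<close>, at height (j + 1) / m, is replaced by
    the first \<open>k\<close> sets of its exhausting union. For positive \<open>m\<close>,
    \<open>h m k\<close> increases in \<open>k\<close> to a staircase within 1 / m of
    \<open>g\<close>.\<close>
  define h where "h m k x = (1 / real m) * (\<Sum>j<m. indicator (V m j k) x)" for m k x
  have conv_V: "convergent_on (indicator (V m j k))" for m j k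
    
  proof -
    have "R m j i \<in> \<R>" for i using R(1)[of m j] by auto
    from convergent_on_Int_UN[OF this \<R>_UNIV, where m = k] show ?thesis by (simp add: V_def)
  qed
  then have conv_h: "convergent_on (h m k)" for m k
    unfolding h_def[abs_def] by (intro convergent_on_cmult convergent_on_sum) auto
  have stairs: "(1 / real m) * (\<Sum>j<m. indicator (U m j) x) \<le> g x"
    "g x \<le> (1 / real m) * (\<Sum>j<m. indicator (U m j) x) + 1 / real m" if "m > 0" for m x
  proof -
    have "real m * g x \<le> real m" using range(2)[of x] by (simp add: mult_left_le)
    then have "min (real m * g x) (real m) = real m * g x" "min (real m * g x) (real (Suc m)) = real m * g x"
      by auto
    moreover have "(\<Sum>j<m. indicator (U m j) x) = (\<Sum>j<m. indicator {real (Suc j)<..} (real m * g x) :: real)"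
      by (intro sum.cong) (auto simp: U_def split: split_indicator)
    ultimately have "(\<Sum>j<m. indicator (U m j) x) \<le> real m * g x"
      "real m * g x \<le> (\<Sum>j<m. indicator (U m j) x) + 1"
      using staircase_bounds[of "real m * g x" m] range(1)[of x] by auto
    then show "(1 / real m) * (\<Sum>j<m. indicator (U m j) x) \<le> g x"
      "g x \<le> (1 / real m) * (\<Sum>j<m. indicator (U m j) x) + 1 / real m"
      using that by (auto simp: field_simps)
  qed
  have h_le: "h m k x \<le> g x" if "m > 0" for m k x
  proof -
    have "V m j k \<subseteq> U m j" for j by (auto simp: V_def R(2))
    then have "h m k x \<le> (1 / real m) * (\<Sum>j<m. indicator (U m j) x)"
      unfolding h_def by (intro mult_left_mono sum_mono) (auto split: split_indicator)
    then show ?thesis using stairs(1)[OF that, of x] by simp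
  qed
  \<comment> \<open>\<open>Suc m\<close> excludes the mesh index 0, where \<open>1 / real m\<close>
    is 0 and the upper staircase bound can fail.\<close>
  have ae1: "AE \<omega> in M. \<forall>m k. (\<lambda>n. L n (h (Suc m) k) \<omega>) \<longlonglongrightarrow> (\<integral>x. h (Suc m) k x \<partial>\<mu> \<omega>)"
    unfolding AE_all_countable using conv_h by (auto simp: convergent_on_def)
  have ae2: "AE \<omega> in M. \<forall>m k n. L n (h (Suc m) k) \<omega> \<le> L n g \<omega>"
    unfolding AE_all_countable using conv_h gb h_le by (auto simp: convergent_on_def intro!: L_mono)
  from ae1 ae2 AE_space show ?thesis
  proof eventually_elim
    fix \<omega>
    assume lim: "\<forall>m k. (\<lambda>n. L n (h (Suc m) k) \<omega>) \<longlonglongrightarrow> (\<integral>x. h (Suc m) k x \<partial>\<mu> \<omega>)"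
      and le: "\<forall>m k n. L n (h (Suc m) k) \<omega> \<le> L n g \<omega>" and \<omega>: "\<omega> \<in> space M"
    interpret \<mu>: prob_space "\<mu> \<omega>" by (rule prob_\<mu>[OF \<omega>])
    note int = integrable_\<mu>[OF \<omega>]
    show "\<forall>c < (\<integral>x. g x \<partial>\<mu> \<omega>). eventually (\<lambda>n. c < L n g \<omega>) sequentially"
    proof (intro allI impI)
      fix c assume "c < (\<integral>x. g x \<partial>\<mu> \<omega>)"
      \<comment> \<open>The gap between \<open>c\<close> and the integral fixes the mesh first;
        \<open>k\<close> is chosen afterwards for this \<open>m\<close>.\<close>
      then obtain m where m: "inverse (real (Suc m)) < (\<integral>x. g x \<partial>\<mu> \<omega>) - c"
        using reals_Archimedean[of "(\<integral>x. g x \<partial>\<mu> \<omega>) - c"] by auto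
      let ?m = "Suc m"
      have int_U: "integrable (\<mu> \<omega>) (\<lambda>x. (1 / real ?m) * (\<Sum>j<?m. indicator (U ?m j) x))"
        by (intro integrable_mult_right Bochner_Integration.integrable_sum int bounded_borel_indicator U_borel)
      have "(\<integral>x. g x \<partial>\<mu> \<omega>) \<le> (\<integral>x. (1 / real ?m) * (\<Sum>j<?m. indicator (U ?m j) x) + 1 / real ?m \<partial>\<mu> \<omega>)"
        by (rule integral_mono[OF int[OF gb] Bochner_Integration.integrable_add[OF int_U \<mu>.integrable_const]])
          (rule stairs(2), simp)
      also have "\<dots> = (\<integral>x. (1 / real ?m) * (\<Sum>j<?m. indicator (U ?m j) x) \<partial>\<mu> \<omega>) + 1 / real ?m"
        by (subst Bochner_Integration.integral_add[OF int_U]) (simp_all add: \<mu>.prob_space)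
      also have "(\<integral>x. (1 / real ?m) * (\<Sum>j<?m. indicator (U ?m j) x) \<partial>\<mu> \<omega>) =
          (1 / real ?m) * (\<Sum>j<?m. measure (\<mu> \<omega>) (U ?m j))"
        by (simp only: integral_mult_right_zero)
          (subst Bochner_Integration.integral_sum, auto intro!: int bounded_borel_indicator U_borel
            simp: integral_indicator_\<mu>[OF \<omega>] simp del: Bochner_Integration.integral_indicator)
      finally have c: "c < (1 / real ?m) * (\<Sum>j<?m. measure (\<mu> \<omega>) (U ?m j))"
        using m by (simp add: inverse_eq_divide)
      have "(\<lambda>k. measure (\<mu> \<omega>) (V ?m j k)) \<longlonglongrightarrow> measure (\<mu> \<omega>) (\<Union>k. V ?m j k)" for j
      proof (rule \<mu>.finite_Lim_measure_incseq)
        show "range (V ?m j) \<subseteq> sets (\<mu> \<omega>)"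
          using R(1)[of ?m j] \<R>_borel by (auto simp: V_def sets_\<mu>[OF \<omega>] intro!: sets.finite_UN)
        show "incseq (V ?m j)" by (fastforce simp: incseq_def V_def)
      qed
      moreover have "(\<Union>k. V ?m j k) = U ?m j" for j
        unfolding V_def R(2) by auto
      ultimately have "(\<lambda>k. (1 / real ?m) * (\<Sum>j<?m. measure (\<mu> \<omega>) (V ?m j k))) \<longlonglongrightarrow>
          (1 / real ?m) * (\<Sum>j<?m. measure (\<mu> \<omega>) (U ?m j))"
        by (intro tendsto_mult_left tendsto_sum) simp
      from order_tendstoD(1)[OF this c] obtain k
        where k: "c < (1 / real ?m) * (\<Sum>j<?m. measure (\<mu> \<omega>) (V ?m j k))"
        by (auto simp: eventually_sequentially)
      have "(\<integral>x. h ?m k x \<partial>\<mu> \<omega>) = (1 / real ?m) * (\<Sum>j<?m. measure (\<mu> \<omega>) (V ?m j k))"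
        unfolding h_def using conv_V
        by (simp only: integral_mult_right_zero)
          (subst Bochner_Integration.integral_sum, auto intro!: int simp: convergent_on_def
            integral_indicator_\<mu>[OF \<omega>] simp del: Bochner_Integration.integral_indicator)
      with k have "c < (\<integral>x. h ?m k x \<partial>\<mu> \<omega>)" by simp
      from order_tendstoD(1)[OF lim[rule_format] this]
      show "eventually (\<lambda>n. c < L n g \<omega>) sequentially"
        by eventually_elim (use le in \<open>auto intro: less_le_trans\<close>)
    qed
  qed
qed

text \<open>Lower bounds for \<open>g\<close> and for \<open>1 - g\<close>, combined with
  convergence on the constant 1, enclose the limit from both sides. An affine change of
  \<open>f\<close> brings the values into [0, 1], as the staircases require.\<close>

theorem AE_tendsto_bcontfun:
  assumes "f \<in> bcontfun"
  shows "AE \<omega> in M. (\<lambda>n. L n f \<omega>) \<longlonglongrightarrow> (\<integral>x. f x \<partial>\<mu> \<omega>)"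
proof -
  have cont: "continuous_on UNIV f" using assms by (simp add: bcontfun_def)
  obtain B where B: "\<And>x. \<bar>f x\<bar> \<le> B" using assms by (auto simp: bcontfun_def bounded_iff)
  \<comment> \<open>The maximum with 1 keeps \<open>2 * C\<close> positive even for
    \<open>f = 0\<close>.\<close>
  define C where "C = max B 1"
  have C: "C > 0" "\<And>x. - C \<le> f x" "\<And>x. f x \<le> C"
    using B by (auto simp: C_def abs_le_iff minus_le_iff le_max_iff_disj)
  define g where "g x = (f x + C) / (2 * C)" for x
  have g_cont: "continuous_on UNIV g" and g'_cont: "continuous_on UNIV (\<lambda>x. 1 - g x)"
    unfolding g_def using C(1) by (auto intro!: continuous_intros cont)
  have g_range: "0 \<le> g x" "g x \<le> 1" for x
    using C(1) C(2)[of x] C(3)[of x] by (auto simp: g_def field_simps)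
  have gb: "bounded_borel g"
    using g_range by (auto simp: bounded_borel_def bounded_iff abs_le_iff
        intro!: borel_measurable_continuous_onI[OF g_cont] exI[of _ 1] order_trans[OF _ g_range(1)])
  have g'b: "bounded_borel (\<lambda>x. 1 - g x)"
    using bounded_borel_add[OF bounded_borel_const[of 1] bounded_borel_cmult[OF gb, of "-1"]] by simp
  have one: "convergent_on (\<lambda>_. 1)"
    using convergent_on_\<R>[OF \<R>_UNIV] by simp
  have ae: "AE \<omega> in M. \<forall>n. L n (\<lambda>_. 1) \<omega> = L n g \<omega> + L n (\<lambda>x. 1 - g x) \<omega>"
    unfolding AE_all_countable using L_add[OF gb g'b] by simp
  have "AE \<omega> in M. (\<lambda>n. L n (\<lambda>_. 1) \<omega>) \<longlonglongrightarrow> (\<integral>x. 1 \<partial>\<mu> \<omega>)"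
    using one by (simp only: convergent_on_def)
  moreover have "AE \<omega> in M. \<forall>c < (\<integral>x. g x \<partial>\<mu> \<omega>). eventually (\<lambda>n. c < L n g \<omega>) sequentially"
    by (rule eventually_gt_of_continuous[OF g_cont g_range])
  moreover have "AE \<omega> in M. \<forall>c < (\<integral>x. 1 - g x \<partial>\<mu> \<omega>). eventually (\<lambda>n. c < L n (\<lambda>x. 1 - g x) \<omega>) sequentially"
    by (rule eventually_gt_of_continuous[OF g'_cont]) (simp_all add: g_range)
  ultimately have "AE \<omega> in M. (\<lambda>n. L n g \<omega>) \<longlonglongrightarrow> (\<integral>x. g x \<partial>\<mu> \<omega>)"
    using ae AE_space
  proof eventually_elim
    fix \<omega>
    assume l1: "(\<lambda>n. L n (\<lambda>_. 1) \<omega>) \<longlonglongrightarrow> (\<integral>x. 1 \<partial>\<mu> \<omega>)"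
      and lo: "\<forall>c < (\<integral>x. g x \<partial>\<mu> \<omega>). eventually (\<lambda>n. c < L n g \<omega>) sequentially"
      and up: "\<forall>c < (\<integral>x. 1 - g x \<partial>\<mu> \<omega>). eventually (\<lambda>n. c < L n (\<lambda>x. 1 - g x) \<omega>) sequentially"
      and sum: "\<forall>n. L n (\<lambda>_. 1) \<omega> = L n g \<omega> + L n (\<lambda>x. 1 - g x) \<omega>"
      and \<omega>: "\<omega> \<in> space M"
    interpret \<mu>: prob_space "\<mu> \<omega>" by (rule prob_\<mu>[OF \<omega>])
    have int1: "(\<integral>x. 1 - g x \<partial>\<mu> \<omega>) = 1 - (\<integral>x. g x \<partial>\<mu> \<omega>)"
      using integrable_\<mu>[OF \<omega> gb] by (simp add: \<mu>.prob_space)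
    show "(\<lambda>n. L n g \<omega>) \<longlonglongrightarrow> (\<integral>x. g x \<partial>\<mu> \<omega>)"
    proof (rule order_tendstoI)
      fix a assume "a < (\<integral>x. g x \<partial>\<mu> \<omega>)"
      then show "eventually (\<lambda>n. a < L n g \<omega>) sequentially" using lo by blast
    next
      fix a assume a: "(\<integral>x. g x \<partial>\<mu> \<omega>) < a"
      \<comment> \<open>Half the gap: one \<open>e\<close> is spent on the constant 1, the other on
        \<open>1 - g\<close>.\<close>
      define e where "e = (a - (\<integral>x. g x \<partial>\<mu> \<omega>)) / 2"
      have "e > 0" using a by (simp add: e_def)
      have "eventually (\<lambda>n. L n (\<lambda>_. 1) \<omega> < 1 + e) sequentially"
        using order_tendstoD(2)[OF l1, of "1 + e"] \<open>e > 0\<close> by (simp add: \<mu>.prob_space)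
      moreover have "eventually (\<lambda>n. 1 - (\<integral>x. g x \<partial>\<mu> \<omega>) - e < L n (\<lambda>x. 1 - g x) \<omega>) sequentially"
        using up \<open>e > 0\<close> unfolding int1 by simp
      ultimately show "eventually (\<lambda>n. L n g \<omega> < a) sequentially"
      proof eventually_elim
        case (elim n)
        then show ?case using sum[rule_format, of n] by (simp add: e_def field_simps)
      qed
    qed
  qed
  then have "convergent_on g" using gb by (simp add: convergent_on_def)
  then have "convergent_on (\<lambda>x. (2 * C) * g x + (- C) * 1)"
    by (intro convergent_on_add convergent_on_cmult one)
  moreover have "(\<lambda>x. (2 * C) * g x + (- C) * 1) = f"
    using C(1) by (auto simp: g_def fun_eq_iff)
  ultimately show ?thesis by (simp add: convergent_on_def)
qed

end

section \<open>Open cylinders and powers of random measures\<close>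

text \<open>Constraining an initial segment of coordinates matches the products over
  \<open>i < k\<close> treated by induction later. Free coordinates take \<open>UNIV\<close>, and
  \<open>k = 0\<close> gives the whole space.\<close>

definition open_cylinders :: "(nat \<Rightarrow> 'e::topological_space) set set" where
  "open_cylinders = {{x. \<forall>i<k. x i \<in> U i} | (k::nat) U. \<forall>i. open (U i)}"

lemma open_cylindersI: "(\<And>i. open (U i)) \<Longrightarrow> {x. \<forall>i<k. x i \<in> U i} \<in> open_cylinders"
  unfolding open_cylinders_def by blast

lemma open_cylindersE:
  assumes "R \<in> open_cylinders"
  obtains k U where "R = {x. \<forall>i<k. x i \<in> U i}" "\<forall>i. open (U i)"
  using assms unfolding open_cylinders_def by blast

lemma open_cylinders_UNIV: "UNIV \<in> open_cylinders"
  using open_cylindersI[of "\<lambda>_. UNIV" 0] by simp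

lemma open_cylinders_empty: "{} \<in> open_cylinders"
  using open_cylindersI[of "\<lambda>_. {}" "Suc 0"] by (auto split: if_splits)

lemma open_cylinders_Int:
  assumes "R \<in> open_cylinders" "S \<in> open_cylinders"
  shows "R \<inter> S \<in> open_cylinders"
proof -
  obtain k U where R: "R = {x. \<forall>i<k. x i \<in> U i}" "\<forall>i. open (U i)"
    using assms(1) by (rule open_cylindersE)
  obtain l V where S: "S = {x. \<forall>i<l. x i \<in> V i}" "\<forall>i. open (V i)"
    using assms(2) by (rule open_cylindersE)
  let ?W = "\<lambda>i. (if i < k then U i else UNIV) \<inter> (if i < l then V i else UNIV)"
  have "{x. \<forall>i<max k l. x i \<in> ?W i} \<in> open_cylinders"
    by (rule open_cylindersI) (auto simp: R S)
  moreover have "{x. \<forall>i<max k l. x i \<in> ?W i} = R \<inter> S"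
    by (auto simp: R S less_max_iff_disj split: if_splits)
  ultimately show ?thesis by simp
qed

lemma open_cylinders_borel:
  fixes R :: "(nat \<Rightarrow> 'e::second_countable_topology) set"
  assumes "R \<in> open_cylinders"
  shows "R \<in> sets borel"
proof -
  obtain k U where R: "R = {x. \<forall>i<k. x i \<in> U i}" "\<forall>i. open (U i)"
    using assms by (rule open_cylindersE)
  have "R = space (PiM UNIV (\<lambda>_. borel)) \<inter> (\<Inter>i\<in>{..<k}. (\<lambda>x. x i) -` U i \<inter> space (PiM UNIV (\<lambda>_. borel)))"
    by (auto simp: R(1) space_PiM)
  also have "\<dots> \<in> sets (PiM UNIV (\<lambda>_. borel))"
  \<comment> \<open>For \<open>k = 0\<close> the intersection is over an empty index set, which
    \<open>sets.finite_INT\<close> excludes.\<close>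
  proof (cases "k = 0")
    case False
    then show ?thesis
      by (intro sets.Int sets.top sets.finite_INT measurable_sets[OF measurable_component_singleton])
        (auto simp: R(2))
  qed simp
  finally show ?thesis by (simp add: sets_PiM_equal_borel)
qed

text \<open>Second countability yields a countable basis of boxes, each restricting finitely many
  coordinates; an upper bound for those coordinates turns a box into an open cylinder.\<close>

lemma open_eq_UN_open_cylinders:
  fixes W :: "(nat \<Rightarrow> 'e::second_countable_topology) set"
  assumes "open W"
  shows "\<exists>R::nat \<Rightarrow> _. range R \<subseteq> open_cylinders \<and> W = (\<Union>i. R i)"
proof -
  obtain K :: "(nat \<Rightarrow> 'e) set set" where K: "topological_basis K" "countable K"
    "\<And>k. k \<in> K \<Longrightarrow> \<exists>X. k = Pi\<^sub>E UNIV X \<and> (\<forall>i. open (X i)) \<and> finite {i. X i \<noteq> UNIV}"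
    using product_topology_countable_basis by fast
  have K_cyl: "k \<in> open_cylinders" if "k \<in> K" for k
  proof -
    obtain X where X: "k = Pi\<^sub>E UNIV X" "\<And>i. open (X i)" "finite {i. X i \<noteq> UNIV}"
      using K(3)[OF \<open>k \<in> K\<close>] by blast
    obtain n where n: "\<And>i. X i \<noteq> UNIV \<Longrightarrow> i < n"
      using X(3) by (auto simp: finite_nat_set_iff_bounded)
    have "k = {x. \<forall>i<n. x i \<in> X i}"
      unfolding X(1) using n by (auto simp: PiE_UNIV_domain)
    then show ?thesis using open_cylindersI[OF X(2)] by simp
  qed
  obtain B where B: "B \<subseteq> K" "\<Union>B = W"
    using topological_basisE[OF K(1)] K(1) assms unfolding topological_basis_def by metis
  show ?thesis
  proof (cases "B = {}")
    \<comment> \<open>\<open>from_nat_into B\<close> enumerates exactly \<open>B\<close> only for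
      nonempty \<open>B\<close>; the empty union is written with the empty cylinder.\<close>
    case True
    then show ?thesis using B open_cylinders_empty by (intro exI[of _ "\<lambda>_. {}"]) auto
  next
    case False
    have "range (from_nat_into B) = B"
      using False countable_subset[OF B(1) K(2)] by (rule range_from_nat_into)
    then show ?thesis using B K_cyl by (intro exI[of _ "from_nat_into B"]) auto
  qed
qed

lemma sets_borel_open_cylinders:
  "sets (borel :: (nat \<Rightarrow> 'e::second_countable_topology) measure) = sigma_sets UNIV open_cylinders"
proof
  show "sigma_sets UNIV open_cylinders \<subseteq> sets (borel :: (nat \<Rightarrow> 'e) measure)"
    using sets.sigma_sets_subset[of open_cylinders "borel :: (nat \<Rightarrow> 'e) measure"] open_cylinders_borel
    by auto
  have "W \<in> sigma_sets UNIV open_cylinders" if W: "open W" for W :: "(nat \<Rightarrow> 'e) set"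
  proof -
    obtain R :: "nat \<Rightarrow> _" where R: "range R \<subseteq> open_cylinders" "W = (\<Union>i. R i)"
      using open_eq_UN_open_cylinders[OF W] by blast
    show ?thesis unfolding R(2) using R(1) by (intro sigma_sets.Union sigma_sets.Basic) auto
  qed
  then have "sigma_sets UNIV {S::(nat \<Rightarrow> 'e) set. open S} \<subseteq> sigma_sets UNIV open_cylinders"
    by (intro sigma_sets_mono) auto
  then show "sets (borel :: (nat \<Rightarrow> 'e) measure) \<subseteq> sigma_sets UNIV open_cylinders"
    by (simp add: borel_def)
qed

lemma indicator_open_cylinder:
  "indicator {x. \<forall>i<k. x i \<in> U i} x = (\<Prod>i<k::nat. indicator (U i) (x i) :: real)"
proof (cases "\<forall>i<k. x i \<in> U i")
  case False
  then obtain i where "i < k" "x i \<notin> U i" by blast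
  then have "(\<Prod>i<k. indicator (U i) (x i) :: real) = 0" by (intro prod_zero bexI[of _ i]) auto
  then show ?thesis using False by simp
qed simp

lemma measure_PiM_open_cylinder:
  fixes \<nu> :: "'e::second_countable_topology measure" and U :: "nat \<Rightarrow> 'e set"
  assumes "prob_space \<nu>" "sets \<nu> = sets borel" "\<And>i. open (U i)"
  shows "measure (PiM UNIV (\<lambda>_. \<nu>)) {x. \<forall>i<k. x i \<in> U i} = (\<Prod>i<k. measure \<nu> (U i))"
proof -
  interpret product_prob_space "\<lambda>_::nat. \<nu>" UNIV
    by (intro product_prob_spaceI assms(1))
  have "space \<nu> = UNIV" using sets_eq_imp_space_eq[OF assms(2)] by simp
  then have "prod_emb UNIV (\<lambda>_. \<nu>) {..<k} (PiE {..<k} U) = {x. \<forall>i<k. x i \<in> U i}"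
    by (auto simp: prod_emb_def space_PiM)
  then show ?thesis
    using measure_PiM_emb[of "{..<k}" U] assms(2,3) by simp
qed

section \<open>Measurability of the infinite power of a random measure\<close>

lemma measurable_measure_random_measure:
  "random_measure M \<gamma> \<Longrightarrow> A \<in> sets borel \<Longrightarrow> (\<lambda>\<omega>. measure (\<gamma> \<omega>) A) \<in> borel_measurable M"
  unfolding random_measure_def by (erule measurable_compose) (rule measurable_measure_prob_algebra)

context
  fixes M :: "'a measure" and \<alpha> :: "'a \<Rightarrow> 'e::polish_space measure"
  assumes \<alpha>: "random_measure M \<alpha>"
begin

lemma random_measure_prob_space: "\<omega> \<in> space M \<Longrightarrow> prob_space (\<alpha> \<omega>)"
  and random_measure_sets: "\<omega> \<in> space M \<Longrightarrow> sets (\<alpha> \<omega>) = sets borel"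
  using measurable_space[of \<alpha> M "prob_algebra borel" \<omega>] \<alpha>
  by (auto simp: random_measure_def space_prob_algebra)

lemma prob_space_iid_power: "\<omega> \<in> space M \<Longrightarrow> prob_space (iid_power \<alpha> \<omega>)"
  unfolding iid_power_def by (intro prob_space_PiM random_measure_prob_space)

lemma sets_iid_power:
  assumes "\<omega> \<in> space M"
  shows "sets (iid_power \<alpha> \<omega>) = sets borel"
proof -
  have "sets (iid_power \<alpha> \<omega>) = sets (PiM UNIV (\<lambda>_::nat. borel :: 'e measure))"
    unfolding iid_power_def by (intro sets_PiM_cong refl random_measure_sets assms)
  then show ?thesis by (simp add: sets_PiM_equal_borel)
qed

lemma measure_iid_power:
  assumes "\<omega> \<in> space M" "\<And>i. open (U i)"
  shows "measure (iid_power \<alpha> \<omega>) {x. \<forall>i<k. x i \<in> U i} = (\<Prod>i<k. measure (\<alpha> \<omega>) (U i))"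
  unfolding iid_power_def
  by (intro measure_PiM_open_cylinder random_measure_prob_space random_measure_sets assms)

text \<open>Open cylinders are an intersection-stable generator, and on a cylinder the power is a
  finite product of the measurable functions
  \<open>measure (\<alpha> \<omega>) (U i)\<close>.\<close>

lemma random_measure_iid_power: "random_measure M (iid_power \<alpha>)"
  unfolding random_measure_def
proof (rule measurable_prob_algebra_generated[OF sets_borel_open_cylinders])
  show "Int_stable (open_cylinders :: (nat \<Rightarrow> 'e) set set)"
    by (auto simp: Int_stable_def intro: open_cylinders_Int)
  fix R :: "(nat \<Rightarrow> 'e) set" assume "R \<in> open_cylinders"
  then obtain k U where R: "R = {x. \<forall>i<k. x i \<in> U i}" "\<forall>i. open (U i)"
    by (rule open_cylindersE)
  have "(\<lambda>\<omega>. ennreal (\<Prod>i<k. measure (\<alpha> \<omega>) (U i))) \<in> borel_measurable M"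
    by (intro measurable_compose[OF _ measurable_ennreal] borel_measurable_prod
        measurable_measure_random_measure[OF \<alpha>]) (simp add: R(2))
  moreover have "emeasure (iid_power \<alpha> \<omega>) R = ennreal (\<Prod>i<k. measure (\<alpha> \<omega>) (U i))"
    if "\<omega> \<in> space M" for \<omega>
  proof -
    interpret prob_space "iid_power \<alpha> \<omega>" using that by (rule prob_space_iid_power)
    show ?thesis
      using measure_iid_power[OF that, of U k] R(2) by (simp add: emeasure_eq_measure R(1))
  qed
  ultimately show "(\<lambda>\<omega>. emeasure (iid_power \<alpha> \<omega>) R) \<in> borel_measurable M"
    by (simp cong: measurable_cong)
qed (auto simp: prob_space_iid_power sets_iid_power)

end

section \<open>Predictive distributions of c.i.d.\ sequences\<close>

text \<open>Links the continuous test functions that specify the directing measure to open sets, by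
  truncated multiples of the distance to the complement.\<close>

lemma open_continuous_approx:
  fixes U :: "'e::metric_space set"
  assumes "open U"
  obtains f :: "nat \<Rightarrow> 'e \<Rightarrow> real"
  where "\<And>m. continuous_on UNIV (f m)" "\<And>m x. 0 \<le> f m x" "\<And>m x. f m x \<le> indicator U x"
    "\<And>x. (\<lambda>m. f m x) \<longlonglongrightarrow> indicator U x"
proof (cases "U = UNIV")
  \<comment> \<open>\<open>infdist\<close> to the empty set is 0 by convention, so the formula of
    the other case would vanish identically here.\<close>
  case True
  then show thesis by (intro that[of "\<lambda>_ _. 1"]) auto
next
  case False
  then have ne: "- U \<noteq> {}" by auto
  let ?f = "\<lambda>m x. min 1 (real m * infdist x (- U))"
  show thesis
  proof (rule that)
    show "continuous_on UNIV (?f m)" for m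
      by (intro continuous_intros)
    show "0 \<le> ?f m x" for m x
      by (simp add: infdist_nonneg)
    show "?f m x \<le> indicator U x" for m x
      by (cases "x \<in> U") auto
    show "(\<lambda>m. ?f m x) \<longlonglongrightarrow> indicator U x" for x
    proof (cases "x \<in> U")
      case True
      have pos: "infdist x (- U) > 0"
        using True assms ne by (intro infdist_pos_not_in_closed) auto
      obtain m0 where m0: "1 / infdist x (- U) < real m0" using reals_Archimedean2 by blast
      have "?f m x = 1" if "m \<ge> m0" for m
      proof -
        have "1 / infdist x (- U) < real m" using m0 that by linarith
        then show ?thesis using pos by (simp add: field_simps min_def)
      qed
      then have "eventually (\<lambda>m. ?f m x = indicator U x) sequentially"
        using True by (intro eventually_sequentiallyI[of m0]) simp
      then show ?thesis by (rule tendsto_eventually)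
    qed simp
  qed
qed

locale cid_sequence = filtered_prob_space +
  fixes X :: "nat \<Rightarrow> 'a \<Rightarrow> 'e::polish_space" and \<alpha> :: "'a \<Rightarrow> 'e measure"
  assumes cid: "cid M G X" and directing: "directing_measure M G X \<alpha>"
begin

lemma random_measure_\<alpha>: "random_measure M \<alpha>"
  using directing by (simp add: directing_measure_def)

lemma X_adapted: "n \<ge> 1 \<Longrightarrow> X n \<in> borel_measurable (G n)"
  using cid by (simp add: cid_def)

lemma X_measurable: "n \<ge> 1 \<Longrightarrow> X n \<in> borel_measurable M"
  by (rule measurable_G_M[OF X_adapted])

lemma ae_bounded_X [ae_bounded_intros]:
  assumes "n \<ge> 1" "bounded_borel f"
  shows "ae_bounded M (\<lambda>\<omega>. f (X n \<omega>))"
proof -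
  obtain K where "\<And>x. \<bar>f x\<bar> \<le> K" using assms(2) by (auto simp: bounded_borel_def bounded_iff)
  moreover have "(\<lambda>\<omega>. f (X n \<omega>)) \<in> borel_measurable M"
    using assms by (intro measurable_compose[OF X_measurable]) (auto simp: bounded_borel_def)
  ultimately show ?thesis by (intro ae_boundedI[of _ _ K]) auto
qed

lemma predictive_eq:
  assumes "bounded_borel f" "n < k"
  shows "AE \<omega> in M. real_cond_exp M (G n) (\<lambda>\<omega>. f (X k \<omega>)) \<omega> =
    real_cond_exp M (G n) (\<lambda>\<omega>. f (X (Suc n) \<omega>)) \<omega>"
  using cid assms by (simp add: cid_def bounded_borel_def)

lemma cond_exp_tower:
  assumes "ae_bounded M f"
  shows "AE \<omega> in M. real_cond_exp M (G n) (real_cond_exp M (G (Suc n)) f) \<omega> = real_cond_exp M (G n) f \<omega>"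
  by (rule cond.real_cond_exp_nested_subalg[OF subalg subalg_G integrable_ae_bounded[OF assms]]) simp

text \<open>The one-step predictions form a bounded martingale: the tower property lowers the
  conditioning from \<open>G (Suc n)\<close> to \<open>G n\<close>, and the c.i.d. property replaces
  \<open>X (Suc (Suc n))\<close> by \<open>X (Suc n)\<close>.\<close>

lemma predictive_convergent:
  assumes f: "bounded_borel f"
  shows "AE \<omega> in M. convergent (\<lambda>n. real_cond_exp M (G n) (\<lambda>\<omega>. f (X (Suc n) \<omega>)) \<omega>)"
proof -
  obtain K where K: "\<And>x. \<bar>f x\<bar> \<le> K" using f by (auto simp: bounded_borel_def bounded_iff)
  show ?thesis
  proof (rule bounded_martingale_converges)
    show "AE \<omega> in M. \<bar>real_cond_exp M (G n) (\<lambda>\<omega>. f (X (Suc n) \<omega>)) \<omega>\<bar> \<le> K" for n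
      by (intro cond_exp_abs_bound ae_bounded_measurable[OF ae_bounded_X] AE_I2 f K) simp
    show "AE \<omega> in M. real_cond_exp M (G n)
        (real_cond_exp M (G (Suc n)) (\<lambda>\<omega>. f (X (Suc (Suc n)) \<omega>))) \<omega> =
        real_cond_exp M (G n) (\<lambda>\<omega>. f (X (Suc n) \<omega>)) \<omega>" for n
    proof -
      have "AE \<omega> in M. real_cond_exp M (G n)
        (real_cond_exp M (G (Suc n)) (\<lambda>\<omega>. f (X (Suc (Suc n)) \<omega>))) \<omega> =
        real_cond_exp M (G n) (\<lambda>\<omega>. f (X (Suc (Suc n)) \<omega>)) \<omega>"
        by (intro cond_exp_tower ae_bounded_intros f) simp
      moreover have "AE \<omega> in M. real_cond_exp M (G n) (\<lambda>\<omega>. f (X (Suc (Suc n)) \<omega>)) \<omega> =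
        real_cond_exp M (G n) (\<lambda>\<omega>. f (X (Suc n) \<omega>)) \<omega>"
        by (intro predictive_eq f) simp
      ultimately show ?thesis by eventually_elim simp
    qed
  qed simp
qed

lemma predictive_tendsto_bcontfun:
  assumes "f \<in> bcontfun"
  shows "AE \<omega> in M. (\<lambda>n. real_cond_exp M (G n) (\<lambda>\<omega>. f (X (Suc n) \<omega>)) \<omega>) \<longlonglongrightarrow> (\<integral>t. f t \<partial>\<alpha> \<omega>)"
proof -
  have "AE \<omega> in M. cid_limit M G X f \<omega> = (\<integral>t. f t \<partial>\<alpha> \<omega>)"
    using directing assms by (simp add: directing_measure_def)
  with predictive_convergent[OF bounded_borel_bcontfun[OF assms]] show ?thesis
  proof eventually_elim
    case (elim \<omega>)
    then show ?case
      using convergent_LIMSEQ_iff[of "\<lambda>n. real_cond_exp M (G n) (\<lambda>\<omega>. f (X (Suc n) \<omega>)) \<omega>"]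
      by (simp add: cid_limit_def)
  qed
qed

text \<open>The c.i.d. property given \<open>G 0\<close> makes all \<open>X k\<close> with
  \<open>k \<ge> 1\<close> identically distributed.\<close>

lemma expectation_predictive:
  assumes f: "bounded_borel f"
  shows "(\<integral>\<omega>. real_cond_exp M (G n) (\<lambda>\<omega>. f (X (Suc n) \<omega>)) \<omega> \<partial>M) = (\<integral>\<omega>. f (X 1 \<omega>) \<partial>M)"
proof -
  have int: "integrable M (\<lambda>\<omega>. f (X (Suc n) \<omega>))" for n
    by (intro integrable_ae_bounded ae_bounded_intros f) simp
  have "(\<integral>\<omega>. real_cond_exp M (G n) (\<lambda>\<omega>. f (X (Suc n) \<omega>)) \<omega> \<partial>M) = (\<integral>\<omega>. f (X (Suc n) \<omega>) \<partial>M)"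
    by (rule cond.real_cond_exp_int(2)[OF int])
  also have "\<dots> = (\<integral>\<omega>. real_cond_exp M (G 0) (\<lambda>\<omega>. f (X (Suc n) \<omega>)) \<omega> \<partial>M)"
    by (rule cond.real_cond_exp_int(2)[OF int, symmetric])
  also have "\<dots> = (\<integral>\<omega>. real_cond_exp M (G 0) (\<lambda>\<omega>. f (X (Suc 0) \<omega>)) \<omega> \<partial>M)"
    by (rule integral_cong_AE[OF _ _ predictive_eq[OF f]]) simp_all
  also have "\<dots> = (\<integral>\<omega>. f (X (Suc 0) \<omega>) \<partial>M)"
    by (rule cond.real_cond_exp_int(2)[OF int])
  finally show ?thesis by simp
qed

text \<open>Dominated convergence, with a bound of \<open>f\<close> as the dominating constant. It
  expresses expectations of limits through the law of \<open>X 1\<close>, the common reference for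
  comparing two candidate limits.\<close>

lemma predictive_limit_expectation:
  assumes f: "bounded_borel f" and V: "V \<in> borel_measurable M"
    and lim: "AE \<omega> in M. (\<lambda>n. real_cond_exp M (G n) (\<lambda>\<omega>. f (X (Suc n) \<omega>)) \<omega>) \<longlonglongrightarrow> V \<omega>"
  shows "integrable M V" "(\<integral>\<omega>. V \<omega> \<partial>M) = (\<integral>\<omega>. f (X 1 \<omega>) \<partial>M)"
proof -
  obtain K where K: "\<And>x. \<bar>f x\<bar> \<le> K" using f by (auto simp: bounded_borel_def bounded_iff)
  have bd: "AE \<omega> in M. norm (real_cond_exp M (G n) (\<lambda>\<omega>. f (X (Suc n) \<omega>)) \<omega>) \<le> K" for n
    unfolding real_norm_def
    by (intro cond_exp_abs_bound ae_bounded_measurable[OF ae_bounded_X] AE_I2 f K) simp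
  show "integrable M V"
    by (rule integrable_dominated_convergence[OF V _ integrable_const lim bd]) simp
  have "(\<lambda>n. \<integral>\<omega>. real_cond_exp M (G n) (\<lambda>\<omega>. f (X (Suc n) \<omega>)) \<omega> \<partial>M) \<longlonglongrightarrow> (\<integral>\<omega>. V \<omega> \<partial>M)"
    by (rule integral_dominated_convergence[OF V _ integrable_const lim bd]) simp
  then show "(\<integral>\<omega>. V \<omega> \<partial>M) = (\<integral>\<omega>. f (X 1 \<omega>) \<partial>M)"
    unfolding expectation_predictive[OF f] by (simp add: LIMSEQ_const_iff)
qed

lemma measurable_integral_\<alpha>:
  fixes f :: "'e \<Rightarrow> real"
  assumes "f \<in> borel_measurable borel"
  shows "(\<lambda>\<omega>. \<integral>t. f t \<partial>\<alpha> \<omega>) \<in> borel_measurable M"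
  using measurable_prob_algebraD[of \<alpha> M borel] random_measure_\<alpha> unfolding random_measure_def
  by (intro measurable_compose[OF _ integral_measurable_subprob_algebra[OF assms]]) simp

text \<open>The limit dominates \<open>\<alpha>(U)\<close> because the indicator of \<open>U\<close> dominates continuous functions
  converging to it, and both sides have the same expectation.\<close>

lemma predictive_tendsto_open:
  assumes U: "open U"
  shows "AE \<omega> in M. (\<lambda>n. real_cond_exp M (G n) (\<lambda>\<omega>. indicator U (X (Suc n) \<omega>)) \<omega>)
    \<longlonglongrightarrow> measure (\<alpha> \<omega>) U"
proof -
  obtain f :: "nat \<Rightarrow> 'e \<Rightarrow> real" where f: "\<And>m. continuous_on UNIV (f m)" "\<And>m x. 0 \<le> f m x"
    "\<And>m x. f m x \<le> indicator U x" "\<And>x. (\<lambda>m. f m x) \<longlonglongrightarrow> indicator U x"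
    by (rule open_continuous_approx[OF U]) blast
  have f_le1: "\<bar>f m x\<bar> \<le> 1" for m x
    using f(2)[of m x] f(3)[of m x] by (cases "x \<in> U") auto
  have fbc: "f m \<in> bcontfun" for m
    using f(1) f_le1 by (auto simp: bcontfun_def bounded_iff intro!: exI[of _ 1])
  note fbb = bounded_borel_bcontfun[OF fbc]
  have fm[measurable]: "f m \<in> borel_measurable borel" for m
    using fbb by (simp add: bounded_borel_def)
  have Ubb: "bounded_borel (indicator U)"
    using U by (intro bounded_borel_indicator) simp
  let ?E = "\<lambda>g n \<omega>. real_cond_exp M (G n) (\<lambda>\<omega>. g (X (Suc n) \<omega>)) \<omega>"
  \<comment> \<open>\<open>V\<close> is measurable by construction and is the actual limit almost
    surely, so it can be integrated before being identified.\<close>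
  define V where "V \<omega> = lim (\<lambda>n. ?E (indicator U) n \<omega>)" for \<omega>
  have V: "V \<in> borel_measurable M"
    unfolding V_def by (rule borel_measurable_lim_metric) simp
  have limV: "AE \<omega> in M. (\<lambda>n. ?E (indicator U) n \<omega>) \<longlonglongrightarrow> V \<omega>"
    using predictive_convergent[OF Ubb]
    by eventually_elim (simp add: V_def convergent_LIMSEQ_iff)
  have limf: "AE \<omega> in M. \<forall>m. (\<lambda>n. ?E (f m) n \<omega>) \<longlonglongrightarrow> (\<integral>t. f m t \<partial>\<alpha> \<omega>)"
    unfolding AE_all_countable by (intro allI predictive_tendsto_bcontfun fbc)
  have mono: "AE \<omega> in M. \<forall>m n. ?E (f m) n \<omega> \<le> ?E (indicator U) n \<omega>"
    unfolding AE_all_countable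
    by (intro allI cond.real_cond_exp_mono integrable_ae_bounded ae_bounded_X fbb Ubb AE_I2 f(3)) simp_all
  have f_lim: "(\<lambda>m. \<integral>t. f m t \<partial>\<alpha> \<omega>) \<longlonglongrightarrow> measure (\<alpha> \<omega>) U" if \<omega>: "\<omega> \<in> space M" for \<omega>
  proof -
    interpret \<alpha>: prob_space "\<alpha> \<omega>" by (rule random_measure_prob_space[OF random_measure_\<alpha> \<omega>])
    note sets = random_measure_sets[OF random_measure_\<alpha> \<omega>]
    have "(\<lambda>m. \<integral>t. f m t \<partial>\<alpha> \<omega>) \<longlonglongrightarrow> (\<integral>t. indicator U t \<partial>\<alpha> \<omega>)"
      by (rule integral_dominated_convergence[where w = "\<lambda>_. 1"])
        (use U f_le1 f(4) in \<open>auto simp: measurable_cong_sets[OF sets refl]\<close>)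
    then show ?thesis using sets_eq_imp_space_eq[OF sets] by simp
  qed
  have le: "AE \<omega> in M. measure (\<alpha> \<omega>) U \<le> V \<omega>"
    using limV limf mono AE_space
  proof eventually_elim
    fix \<omega>
    assume l1: "(\<lambda>n. ?E (indicator U) n \<omega>) \<longlonglongrightarrow> V \<omega>"
      and l2: "\<forall>m. (\<lambda>n. ?E (f m) n \<omega>) \<longlonglongrightarrow> (\<integral>t. f m t \<partial>\<alpha> \<omega>)"
      and mo: "\<forall>m n. ?E (f m) n \<omega> \<le> ?E (indicator U) n \<omega>" and \<omega>: "\<omega> \<in> space M"
    have "(\<integral>t. f m t \<partial>\<alpha> \<omega>) \<le> V \<omega>" for m
      by (rule LIMSEQ_le[OF l2[rule_format] l1]) (use mo in auto)
    then show "measure (\<alpha> \<omega>) U \<le> V \<omega>"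
      by (intro LIMSEQ_le_const2[OF f_lim[OF \<omega>]]) auto
  qed
  have \<alpha>U: "(\<lambda>\<omega>. measure (\<alpha> \<omega>) U) \<in> borel_measurable M"
    using U by (intro measurable_measure_random_measure[OF random_measure_\<alpha>]) simp
  have \<alpha>_int: "integrable M (\<lambda>\<omega>. measure (\<alpha> \<omega>) U)"
  proof (rule integrable_const_bound[of _ 1])
    show "AE \<omega> in M. norm (measure (\<alpha> \<omega>) U) \<le> 1"
      using AE_space by eventually_elim
        (simp add: prob_space.prob_le_1 random_measure_prob_space[OF random_measure_\<alpha>])
  qed (rule \<alpha>U)
  have lim1: "(\<lambda>m. \<integral>\<omega>. (\<integral>t. f m t \<partial>\<alpha> \<omega>) \<partial>M) \<longlonglongrightarrow> (\<integral>\<omega>. measure (\<alpha> \<omega>) U \<partial>M)"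
  proof (rule integral_dominated_convergence[OF \<alpha>U measurable_integral_\<alpha>[OF fm] integrable_const])
    show "AE \<omega> in M. (\<lambda>m. \<integral>t. f m t \<partial>\<alpha> \<omega>) \<longlonglongrightarrow> measure (\<alpha> \<omega>) U"
      using AE_space by eventually_elim (rule f_lim)
    show "AE \<omega> in M. norm (\<integral>t. f m t \<partial>\<alpha> \<omega>) \<le> 1" for m
      using AE_space
    proof eventually_elim
      fix \<omega> assume \<omega>: "\<omega> \<in> space M"
      interpret \<alpha>: prob_space "\<alpha> \<omega>" by (rule random_measure_prob_space[OF random_measure_\<alpha> \<omega>])
      have int: "integrable (\<alpha> \<omega>) (f m)"
        by (intro integrable_bounded_borel fbb random_measure_sets[OF random_measure_\<alpha> \<omega>] \<alpha>.prob_space_axioms)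
      have "0 \<le> (\<integral>t. f m t \<partial>\<alpha> \<omega>)" by (rule Bochner_Integration.integral_nonneg) (rule f(2))
      moreover have "f m t \<le> 1" for t using f_le1[of m t] by simp
      then have "(\<integral>t. f m t \<partial>\<alpha> \<omega>) \<le> 1" by (intro \<alpha>.integral_le_const int AE_I2)
      ultimately show "norm (\<integral>t. f m t \<partial>\<alpha> \<omega>) \<le> 1" by simp
    qed
  qed
  \<comment> \<open>Letting \<open>m\<close> grow in this identity shows that
    \<open>measure (\<alpha> \<omega>) U\<close> has expectation P(X 1 in U), which is also that of
    \<open>V\<close>; with \<open>le\<close> this forces almost sure equality.\<close>
  have "(\<integral>\<omega>. (\<integral>t. f m t \<partial>\<alpha> \<omega>) \<partial>M) = (\<integral>\<omega>. f m (X 1 \<omega>) \<partial>M)" for m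
    by (rule predictive_limit_expectation(2)[OF fbb measurable_integral_\<alpha>[OF fm] predictive_tendsto_bcontfun[OF fbc]])
  moreover have "(\<lambda>m. \<integral>\<omega>. f m (X 1 \<omega>) \<partial>M) \<longlonglongrightarrow> (\<integral>\<omega>. indicator U (X 1 \<omega>) \<partial>M)"
    by (rule integral_dominated_convergence[where w = "\<lambda>_. 1"])
      (use f_le1 f(4) ae_bounded_measurable[OF ae_bounded_X[OF order_refl]] Ubb fbb in auto)
  ultimately have "(\<integral>\<omega>. measure (\<alpha> \<omega>) U \<partial>M) = (\<integral>\<omega>. indicator U (X 1 \<omega>) \<partial>M)"
    using lim1 LIMSEQ_unique by simp
  then have "(\<integral>\<omega>. V \<omega> - measure (\<alpha> \<omega>) U \<partial>M) = 0"
    using predictive_limit_expectation[OF Ubb V limV] \<alpha>_int by simp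
  moreover have "integrable M (\<lambda>\<omega>. V \<omega> - measure (\<alpha> \<omega>) U)"
    using predictive_limit_expectation(1)[OF Ubb V limV] \<alpha>_int by simp
  moreover have "AE \<omega> in M. 0 \<le> V \<omega> - measure (\<alpha> \<omega>) U" using le by eventually_elim simp
  ultimately have "AE \<omega> in M. V \<omega> - measure (\<alpha> \<omega>) U = 0"
    by (subst integral_nonneg_eq_0_iff_AE[symmetric])
  with limV show ?thesis by eventually_elim simp
qed

end

section \<open>Convergence of the futures\<close>

lemma abs_prod_le_1:
  fixes f :: "'i \<Rightarrow> real"
  shows "(\<And>i. i \<in> I \<Longrightarrow> \<bar>f i\<bar> \<le> 1) \<Longrightarrow> \<bar>\<Prod>i\<in>I. f i\<bar> \<le> 1"
  unfolding abs_prod by (intro prod_le_1) simp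

section \<open>Transfer of convergence to integrals over a fixed event\<close>

context filtered_prob_space
begin

text \<open>Let \<open>N\<^sub>n = E[1\<^sub>H | G\<^sub>n]\<close>. Then \<open>E[1\<^sub>H Y\<^sub>n] = E[N\<^sub>n\<^sub>+\<^sub>k Y\<^sub>n]\<close>,
  \<open>E[1\<^sub>H E[Y\<^sub>n | G\<^sub>n]] = E[N\<^sub>n Y\<^sub>n]\<close>, and \<open>N\<close> converges almost surely.\<close>

lemma tendsto_integral_indicator_mult:
  assumes H: "H \<in> sets M"
    and Y: "\<And>n. Y n \<in> borel_measurable (G (n + k))" "\<And>n \<omega>. \<bar>Y n \<omega>\<bar> \<le> 1"
    and W: "W \<in> borel_measurable M"
    and lim: "AE \<omega> in M. (\<lambda>n. real_cond_exp M (G n) (Y n) \<omega>) \<longlonglongrightarrow> W \<omega>"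
  shows "(\<lambda>n. \<integral>\<omega>. indicator H \<omega> * Y n \<omega> \<partial>M) \<longlonglongrightarrow> (\<integral>\<omega>. indicator H \<omega> * W \<omega> \<partial>M)"
proof -
  define N where "N n = real_cond_exp M (G n) (indicator H)" for n
  have YM[measurable]: "Y n \<in> borel_measurable M" for n
    by (rule measurable_G_M[OF Y(1)])
  have [measurable]: "N n \<in> borel_measurable M" for n by (simp add: N_def)
  have Yb[ae_bounded_intros]: "ae_bounded M (Y n)" for n
    by (rule ae_boundedI[of _ _ 1]) (use Y(2) in auto)
  have Nb[ae_bounded_intros]: "ae_bounded M (N n)" for n
    unfolding N_def by (intro ae_bounded_intros H)
  have N1: "AE \<omega> in M. \<bar>N n \<omega>\<bar> \<le> 1" for n
    unfolding N_def by (intro cond_exp_abs_bound borel_measurable_indicator H) simp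
  have E1: "AE \<omega> in M. \<bar>real_cond_exp M (G n) (Y n) \<omega>\<bar> \<le> 1" for n
    by (intro cond_exp_abs_bound YM AE_I2 Y(2))
  have "AE \<omega> in M. convergent (\<lambda>n. N n \<omega>)"
  proof (rule bounded_martingale_converges[OF _ N1])
    show "N n \<in> borel_measurable (G n)" for n by (simp add: N_def)
    show "AE \<omega> in M. real_cond_exp M (G n) (N (Suc n)) \<omega> = N n \<omega>" for n
      unfolding N_def
      by (rule cond.real_cond_exp_nested_subalg[OF subalg subalg_G integrable_ae_bounded])
        (simp, intro ae_bounded_intros H)
  qed
  \<comment> \<open>\<open>k\<close> is fixed, so \<open>N (n + k)\<close> and \<open>N n\<close>
    have the same limit, and \<open>Y n\<close> is bounded.\<close>
  then have D0: "AE \<omega> in M. (\<lambda>n. (N (n + k) \<omega> - N n \<omega>) * Y n \<omega>) \<longlonglongrightarrow> 0"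
  proof eventually_elim
    fix \<omega> assume "convergent (\<lambda>n. N n \<omega>)"
    then obtain l where l: "(\<lambda>n. N n \<omega>) \<longlonglongrightarrow> l" by (auto simp: convergent_def)
    have "(\<lambda>n. N (n + k) \<omega> - N n \<omega>) \<longlonglongrightarrow> 0"
      using tendsto_diff[OF LIMSEQ_ignore_initial_segment[OF l, of k] l] by simp
    then have "(\<lambda>n. \<bar>N (n + k) \<omega> - N n \<omega>\<bar>) \<longlonglongrightarrow> 0" by (rule tendsto_rabs_zero)
    then show "(\<lambda>n. (N (n + k) \<omega> - N n \<omega>) * Y n \<omega>) \<longlonglongrightarrow> 0"
      by (rule Lim_null_comparison[rotated])
        (use Y(2) in \<open>auto simp: abs_mult intro!: always_eventually mult_right_le_one_le\<close>)
  qed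
  have "(\<lambda>n. \<integral>\<omega>. (N (n + k) \<omega> - N n \<omega>) * Y n \<omega> \<partial>M) \<longlonglongrightarrow> (\<integral>\<omega>. 0 \<partial>M)"
  proof (rule integral_dominated_convergence[OF _ _ integrable_const D0])
    show "AE \<omega> in M. norm ((N (n + k) \<omega> - N n \<omega>) * Y n \<omega>) \<le> 2 * 1" for n
      using N1[of "n + k"] N1[of n]
    proof eventually_elim
      case (elim \<omega>)
      then show ?case
        using Y(2)[of n \<omega>] unfolding real_norm_def abs_mult by (intro mult_mono) auto
    qed
  qed simp_all
  moreover have "(\<integral>\<omega>. (N (n + k) \<omega> - N n \<omega>) * Y n \<omega> \<partial>M) =
      (\<integral>\<omega>. indicator H \<omega> * Y n \<omega> \<partial>M) - (\<integral>\<omega>. indicator H \<omega> * real_cond_exp M (G n) (Y n) \<omega> \<partial>M)" for n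
  proof -
    have "(\<integral>\<omega>. Y n \<omega> * N (n + k) \<omega> \<partial>M) = (\<integral>\<omega>. Y n \<omega> * indicator H \<omega> \<partial>M)"
      unfolding N_def
      by (intro cond.real_cond_exp_intg(2) integrable_ae_bounded ae_bounded_intros H Y(1) borel_measurable_indicator)
    moreover have "(\<integral>\<omega>. N n \<omega> * real_cond_exp M (G n) (Y n) \<omega> \<partial>M) = (\<integral>\<omega>. N n \<omega> * Y n \<omega> \<partial>M)"
      by (intro cond.real_cond_exp_intg(2) integrable_ae_bounded ae_bounded_intros YM) (simp add: N_def)
    moreover have "(\<integral>\<omega>. real_cond_exp M (G n) (Y n) \<omega> * N n \<omega> \<partial>M) =
        (\<integral>\<omega>. real_cond_exp M (G n) (Y n) \<omega> * indicator H \<omega> \<partial>M)"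
      unfolding N_def
      by (intro cond.real_cond_exp_intg(2) integrable_ae_bounded ae_bounded_intros H borel_measurable_cond_exp
          borel_measurable_indicator)
    moreover have "(\<integral>\<omega>. N (n + k) \<omega> * Y n \<omega> - N n \<omega> * Y n \<omega> \<partial>M) =
        (\<integral>\<omega>. N (n + k) \<omega> * Y n \<omega> \<partial>M) - (\<integral>\<omega>. N n \<omega> * Y n \<omega> \<partial>M)"
      by (intro Bochner_Integration.integral_diff integrable_ae_bounded ae_bounded_intros)
    moreover have "(\<integral>\<omega>. (N (n + k) \<omega> - N n \<omega>) * Y n \<omega> \<partial>M) =
        (\<integral>\<omega>. N (n + k) \<omega> * Y n \<omega> - N n \<omega> * Y n \<omega> \<partial>M)"
      by (simp only: left_diff_distrib)
    ultimately show ?thesis by (simp only: mult.commute)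
  qed
  ultimately have "(\<lambda>n. (\<integral>\<omega>. indicator H \<omega> * Y n \<omega> \<partial>M) -
      (\<integral>\<omega>. indicator H \<omega> * real_cond_exp M (G n) (Y n) \<omega> \<partial>M)) \<longlonglongrightarrow> 0"
    by simp
  moreover have "(\<lambda>n. \<integral>\<omega>. indicator H \<omega> * real_cond_exp M (G n) (Y n) \<omega> \<partial>M) \<longlonglongrightarrow>
      (\<integral>\<omega>. indicator H \<omega> * W \<omega> \<partial>M)"
  proof (rule integral_dominated_convergence[OF _ _ integrable_const])
    show "AE \<omega> in M. (\<lambda>n. indicator H \<omega> * real_cond_exp M (G n) (Y n) \<omega>) \<longlonglongrightarrow> indicator H \<omega> * W \<omega>"
      using lim by eventually_elim (rule tendsto_mult_left)
    show "AE \<omega> in M. norm (indicator H \<omega> * real_cond_exp M (G n) (Y n) \<omega>) \<le> 1" for n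
      using E1[of n] by eventually_elim (simp add: abs_mult split: split_indicator)
  qed (use W H in \<open>auto intro!: borel_measurable_times borel_measurable_indicator\<close>)
  ultimately have "(\<lambda>n. ((\<integral>\<omega>. indicator H \<omega> * Y n \<omega> \<partial>M) -
      (\<integral>\<omega>. indicator H \<omega> * real_cond_exp M (G n) (Y n) \<omega> \<partial>M)) +
      (\<integral>\<omega>. indicator H \<omega> * real_cond_exp M (G n) (Y n) \<omega> \<partial>M)) \<longlonglongrightarrow>
      0 + (\<integral>\<omega>. indicator H \<omega> * W \<omega> \<partial>M)"
    by (rule tendsto_add)
  then show ?thesis by simp
qed

end

section \<open>Products over consecutive coordinates, cylinders, and bounded continuous functions of
  the future\<close>

context cid_sequence
begin

text \<open>Factors and limits are kept arbitrary because the induction hypothesis is applied to the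
  shifted families \<open>f (Suc i)\<close> and \<open>v (Suc i)\<close>. The bound 1 is inherited
  by products.\<close>

lemma predictive_product_tendsto:
  assumes "\<And>i. f i \<in> borel_measurable borel" "\<And>i x. \<bar>f i x\<bar> \<le> 1"
    and "\<And>i. AE \<omega> in M. (\<lambda>n. real_cond_exp M (G n) (\<lambda>\<omega>. f i (X (Suc n) \<omega>)) \<omega>) \<longlonglongrightarrow> v i \<omega>"
  shows "AE \<omega> in M. (\<lambda>n. real_cond_exp M (G n) (\<lambda>\<omega>. \<Prod>i<k::nat. f i (X (Suc n + i) \<omega>)) \<omega>)
    \<longlonglongrightarrow> (\<Prod>i<k. v i \<omega>)"
  using assms
proof (induction k arbitrary: f v)
  case 0
  have "AE \<omega> in M. \<forall>n. real_cond_exp M (G n) (\<lambda>\<omega>. 1) \<omega> = 1"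
    unfolding AE_all_countable by (intro allI cond.real_cond_exp_F_meas) simp_all
  then show ?case by eventually_elim simp
next
  case (Suc k)
  have fX[measurable]: "(\<lambda>\<omega>. f i (X (Suc m) \<omega>)) \<in> borel_measurable M" for i m
    by (rule measurable_compose[OF X_measurable Suc.prems(1)]) simp
  \<comment> \<open>\<open>Q\<close> pairs the shifted functions with coordinates starting at
    \<open>Suc n\<close>, so the remaining factors of the product at time \<open>n\<close> are
    \<open>Q (Suc n)\<close>.\<close>
  define Q where "Q n \<omega> = (\<Prod>i<k. f (Suc i) (X (Suc n + i) \<omega>))" for n \<omega>
  define Y where "Y n = real_cond_exp M (G n) (Q n)" for n
  define a where "a n \<omega> = f 0 (X (Suc n) \<omega>)" for n \<omega>
  have QM[measurable]: "Q n \<in> borel_measurable M" for n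
    unfolding Q_def[abs_def] by simp
  have aM[measurable]: "a n \<in> borel_measurable M" for n
    unfolding a_def[abs_def] by (rule fX)
  have aG: "a n \<in> borel_measurable (G (Suc n))" for n
    unfolding a_def[abs_def] by (rule measurable_compose[OF X_adapted Suc.prems(1)]) simp
  have YM[measurable]: "Y n \<in> borel_measurable M" for n by (simp add: Y_def)
  have Q1: "\<bar>Q n \<omega>\<bar> \<le> 1" for n \<omega> unfolding Q_def by (intro abs_prod_le_1 Suc.prems(2))
  have a1: "\<bar>a n \<omega>\<bar> \<le> 1" for n \<omega> unfolding a_def by (rule Suc.prems(2))
  have Y1: "AE \<omega> in M. \<bar>Y n \<omega>\<bar> \<le> 1" for n
    unfolding Y_def by (intro cond_exp_abs_bound QM AE_I2 Q1)
  have [ae_bounded_intros]: "ae_bounded M (Q n)" "ae_bounded M (a n)" "ae_bounded M (Y n)" for n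
    using Q1 a1 Y1 by (auto intro!: ae_boundedI[of _ _ 1])
  have Ylim: "AE \<omega> in M. (\<lambda>n. Y n \<omega>) \<longlonglongrightarrow> (\<Prod>i<k. v (Suc i) \<omega>)"
    unfolding Y_def Q_def[abs_def] by (rule Suc.IH) (use Suc.prems in auto)
  \<comment> \<open>The error of replacing \<open>Y (Suc n)\<close> by \<open>Y n\<close>. The
    replacement is made because \<open>Y n\<close> is \<open>G n\<close>-measurable and can be taken
    out of the conditional expectation.\<close>
  define D where "D n \<omega> = a n \<omega> * (Y (Suc n) \<omega> - Y n \<omega>)" for n \<omega>
  have DM[measurable]: "D n \<in> borel_measurable M" for n unfolding D_def[abs_def] by simp
  have Db[ae_bounded_intros]: "ae_bounded M (D n)" for n
    unfolding D_def[abs_def] by (intro ae_bounded_intros)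
  have Dlim: "AE \<omega> in M. (\<lambda>n. real_cond_exp M (G n) (D n) \<omega>) \<longlonglongrightarrow> 0"
  proof (rule cond_exp_null_sequence[OF DM])
    show "AE \<omega> in M. \<bar>D n \<omega>\<bar> \<le> 1 * 2" for n
      using Y1[of n] Y1[of "Suc n"]
    proof eventually_elim
      case (elim \<omega>)
      then show ?case unfolding D_def abs_mult using a1[of n \<omega>] by (intro mult_mono) auto
    qed
    show "AE \<omega> in M. (\<lambda>n. D n \<omega>) \<longlonglongrightarrow> 0"
      using Ylim
    proof eventually_elim
      fix \<omega> assume l: "(\<lambda>n. Y n \<omega>) \<longlonglongrightarrow> (\<Prod>i<k. v (Suc i) \<omega>)"
      have "(\<lambda>n. Y (Suc n) \<omega> - Y n \<omega>) \<longlonglongrightarrow> 0"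
        using tendsto_diff[OF LIMSEQ_Suc[OF l] l] by simp
      then have "(\<lambda>n. \<bar>Y (Suc n) \<omega> - Y n \<omega>\<bar>) \<longlonglongrightarrow> 0" by (rule tendsto_rabs_zero)
      then show "(\<lambda>n. D n \<omega>) \<longlonglongrightarrow> 0"
        by (rule Lim_null_comparison[rotated])
          (use a1 in \<open>auto simp: D_def abs_mult intro!: always_eventually mult_left_le_one_le\<close>)
    qed
  qed
  have eq: "AE \<omega> in M. \<forall>n. real_cond_exp M (G n) (\<lambda>\<omega>. \<Prod>i<Suc k. f i (X (Suc n + i) \<omega>)) \<omega> =
      real_cond_exp M (G n) (D n) \<omega> + Y n \<omega> * real_cond_exp M (G n) (a n) \<omega>"
  proof (unfold AE_all_countable, rule allI)
    fix n
    let ?P = "\<lambda>\<omega>. a n \<omega> * Q (Suc n) \<omega>"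
    have P: "(\<lambda>\<omega>. \<Prod>i<Suc k. f i (X (Suc n + i) \<omega>)) = ?P"
      by (simp add: fun_eq_iff a_def Q_def prod.lessThan_Suc_shift del: prod.lessThan_Suc)
    have "AE \<omega> in M. real_cond_exp M (G n) (real_cond_exp M (G (Suc n)) ?P) \<omega> = real_cond_exp M (G n) ?P \<omega>"
      by (intro cond_exp_tower ae_bounded_intros)
    moreover have "AE \<omega> in M. real_cond_exp M (G n) (real_cond_exp M (G (Suc n)) ?P) \<omega> =
        real_cond_exp M (G n) (\<lambda>\<omega>. D n \<omega> + Y n \<omega> * a n \<omega>) \<omega>"
    proof (rule cond.real_cond_exp_cong)
      have "AE \<omega> in M. real_cond_exp M (G (Suc n)) ?P \<omega> = a n \<omega> * Y (Suc n) \<omega>"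
        unfolding Y_def
        by (intro cond.real_cond_exp_mult aG QM integrable_ae_bounded ae_bounded_intros)
      then show "AE \<omega> in M. real_cond_exp M (G (Suc n)) ?P \<omega> = D n \<omega> + Y n \<omega> * a n \<omega>"
        by eventually_elim (simp add: D_def algebra_simps)
    qed simp_all
    moreover have "AE \<omega> in M. real_cond_exp M (G n) (\<lambda>\<omega>. D n \<omega> + Y n \<omega> * a n \<omega>) \<omega> =
        real_cond_exp M (G n) (D n) \<omega> + real_cond_exp M (G n) (\<lambda>\<omega>. Y n \<omega> * a n \<omega>) \<omega>"
      by (intro cond.real_cond_exp_add integrable_ae_bounded ae_bounded_intros)
    moreover have "AE \<omega> in M. real_cond_exp M (G n) (\<lambda>\<omega>. Y n \<omega> * a n \<omega>) \<omega> =
        Y n \<omega> * real_cond_exp M (G n) (a n) \<omega>"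
      by (intro cond.real_cond_exp_mult aM integrable_ae_bounded ae_bounded_intros) (simp add: Y_def)
    ultimately show "AE \<omega> in M. real_cond_exp M (G n) (\<lambda>\<omega>. \<Prod>i<Suc k. f i (X (Suc n + i) \<omega>)) \<omega> =
      real_cond_exp M (G n) (D n) \<omega> + Y n \<omega> * real_cond_exp M (G n) (a n) \<omega>"
      unfolding P by eventually_elim simp
  qed
  have alim: "AE \<omega> in M. (\<lambda>n. real_cond_exp M (G n) (a n) \<omega>) \<longlonglongrightarrow> v 0 \<omega>"
    unfolding a_def[abs_def] by (rule Suc.prems(3))
  from eq Dlim Ylim alim show ?case
  proof eventually_elim
    fix \<omega>
    assume e: "\<forall>n. real_cond_exp M (G n) (\<lambda>\<omega>. \<Prod>i<Suc k. f i (X (Suc n + i) \<omega>)) \<omega> =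
        real_cond_exp M (G n) (D n) \<omega> + Y n \<omega> * real_cond_exp M (G n) (a n) \<omega>"
      and l: "(\<lambda>n. real_cond_exp M (G n) (D n) \<omega>) \<longlonglongrightarrow> 0"
        "(\<lambda>n. Y n \<omega>) \<longlonglongrightarrow> (\<Prod>i<k. v (Suc i) \<omega>)"
        "(\<lambda>n. real_cond_exp M (G n) (a n) \<omega>) \<longlonglongrightarrow> v 0 \<omega>"
    have "(\<lambda>n. real_cond_exp M (G n) (D n) \<omega> + Y n \<omega> * real_cond_exp M (G n) (a n) \<omega>)
        \<longlonglongrightarrow> 0 + (\<Prod>i<k. v (Suc i) \<omega>) * v 0 \<omega>"
      by (intro tendsto_add tendsto_mult l)
    moreover have "0 + (\<Prod>i<k. v (Suc i) \<omega>) * v 0 \<omega> = (\<Prod>i<Suc k. v i \<omega>)"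
      by (simp add: prod.lessThan_Suc_shift del: prod.lessThan_Suc)
    ultimately show "(\<lambda>n. real_cond_exp M (G n) (\<lambda>\<omega>. \<Prod>i<Suc k. f i (X (Suc n + i) \<omega>)) \<omega>)
        \<longlonglongrightarrow> (\<Prod>i<Suc k. v i \<omega>)"
      using e by simp
  qed
qed

abbreviation future :: "nat \<Rightarrow> 'a \<Rightarrow> nat \<Rightarrow> 'e" where
  "future n \<omega> \<equiv> \<lambda>i. X (n + i) \<omega>"

lemma future_measurable:
  assumes "n \<ge> 1"
  shows "future n \<in> borel_measurable M"
proof -
  have "future n \<in> M \<rightarrow>\<^sub>M PiM UNIV (\<lambda>_. borel)"
    by (rule measurable_PiM_single') (use assms X_measurable in auto)
  then show ?thesis
    by (simp add: measurable_cong_sets[OF refl sets_PiM_equal_borel])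
qed

lemma ae_bounded_future [ae_bounded_intros]:
  assumes "n \<ge> 1" "bounded_borel f"
  shows "ae_bounded M (\<lambda>\<omega>. f (future n \<omega>))"
proof -
  obtain K where "\<And>x. \<bar>f x\<bar> \<le> K" using assms(2) by (auto simp: bounded_borel_def bounded_iff)
  moreover have "(\<lambda>\<omega>. f (future n \<omega>)) \<in> borel_measurable M"
    using assms by (intro measurable_compose[OF future_measurable]) (auto simp: bounded_borel_def)
  ultimately show ?thesis by (intro ae_boundedI[of _ _ K]) auto
qed

lemma predictive_cylinder_tendsto:
  assumes U: "\<And>i. open (U i)"
  shows "AE \<omega> in M. (\<lambda>n. real_cond_exp M (G n) (\<lambda>\<omega>. \<Prod>i<k::nat. indicator (U i) (X (Suc n + i) \<omega>)) \<omega>)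
    \<longlonglongrightarrow> (\<Prod>i<k. measure (\<alpha> \<omega>) (U i))"
  by (rule predictive_product_tendsto) (use U in \<open>auto intro: predictive_tendsto_open\<close>)

lemma predictive_tendsto_iid_power:
  assumes "g \<in> bcontfun"
  shows "AE \<omega> in M. (\<lambda>n. real_cond_exp M (G n) (\<lambda>\<omega>. g (future (Suc n) \<omega>)) \<omega>)
    \<longlonglongrightarrow> (\<integral>x. g x \<partial>iid_power \<alpha> \<omega>)"
proof -
  interpret P: almost_surely_positive_functionals M
    "\<lambda>n g. real_cond_exp M (G n) (\<lambda>\<omega>. g (future (Suc n) \<omega>))" "iid_power \<alpha>" open_cylinders
  proof (intro almost_surely_positive_functionals.intro almost_surely_positive_functionals_axioms.intro)
    fix R :: "(nat \<Rightarrow> 'e) set" assume "R \<in> open_cylinders"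
    then obtain k U where R: "R = {x. \<forall>i<k. x i \<in> U i}" "\<forall>i. open (U i)"
      by (rule open_cylindersE) blast
    have "AE \<omega> in M. (\<lambda>n. real_cond_exp M (G n) (\<lambda>\<omega>. \<Prod>i<k::nat. indicator (U i) (X (Suc n + i) \<omega>)) \<omega>)
      \<longlonglongrightarrow> (\<Prod>i<k. measure (\<alpha> \<omega>) (U i))"
      using R(2) by (intro predictive_cylinder_tendsto) simp
    then show "AE \<omega> in M. (\<lambda>n. real_cond_exp M (G n) (\<lambda>\<omega>. indicator R (future (Suc n) \<omega>)) \<omega>)
      \<longlonglongrightarrow> measure (iid_power \<alpha> \<omega>) R"
      using AE_space unfolding R(1) indicator_open_cylinder
      by eventually_elim (simp add: measure_iid_power[OF random_measure_\<alpha>] R(2))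
  next
    have int: "integrable M (\<lambda>\<omega>. f (future (Suc n) \<omega>))" if "bounded_borel f" for n f
      using that by (intro integrable_ae_bounded ae_bounded_future) simp
    fix n and f h :: "(nat \<Rightarrow> 'e) \<Rightarrow> real" and c :: real
    assume f: "bounded_borel f"
    show "AE \<omega> in M. real_cond_exp M (G n) (\<lambda>\<omega>. c * f (future (Suc n) \<omega>)) \<omega> =
        c * real_cond_exp M (G n) (\<lambda>\<omega>. f (future (Suc n) \<omega>)) \<omega>"
      by (rule cond.real_cond_exp_cmult[OF int[OF f]])
    assume h: "bounded_borel h"
    show "AE \<omega> in M. real_cond_exp M (G n) (\<lambda>\<omega>. f (future (Suc n) \<omega>) + h (future (Suc n) \<omega>)) \<omega> =
        real_cond_exp M (G n) (\<lambda>\<omega>. f (future (Suc n) \<omega>)) \<omega> +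
        real_cond_exp M (G n) (\<lambda>\<omega>. h (future (Suc n) \<omega>)) \<omega>"
      by (rule cond.real_cond_exp_add[OF int[OF f] int[OF h]])
    assume "\<And>x. f x \<le> h x"
    then show "AE \<omega> in M. real_cond_exp M (G n) (\<lambda>\<omega>. f (future (Suc n) \<omega>)) \<omega> \<le>
        real_cond_exp M (G n) (\<lambda>\<omega>. h (future (Suc n) \<omega>)) \<omega>"
      by (intro cond.real_cond_exp_mono[OF _ int[OF f] int[OF h]] AE_I2)
  next
    show "R \<in> sets borel" if "R \<in> open_cylinders" for R :: "(nat \<Rightarrow> 'e) set"
      using that by (rule open_cylinders_borel)
    show "R \<inter> S \<in> open_cylinders" if "R \<in> open_cylinders" "S \<in> open_cylinders" for R S :: "(nat \<Rightarrow> 'e) set"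
      using that by (rule open_cylinders_Int)
    show "\<exists>R::nat \<Rightarrow> _. range R \<subseteq> open_cylinders \<and> W = (\<Union>i. R i)" if "open W" for W :: "(nat \<Rightarrow> 'e) set"
      using that by (rule open_eq_UN_open_cylinders)
  qed (rule prob_space_axioms open_cylinders_UNIV prob_space_iid_power[OF random_measure_\<alpha>]
      sets_iid_power[OF random_measure_\<alpha>] | assumption)+
  show ?thesis by (rule P.AE_tendsto_bcontfun[OF assms])
qed

text \<open>The functionals are now integrals against the laws under P( . | H) and do not depend on
  the sample point, so the almost sure limit is an ordinary one. The c.i.d. property enters through
  cylinders only, by \<open>tendsto_integral_indicator_mult\<close>.\<close>

lemma stable_convergence: "converges_stably M future (iid_power \<alpha>)"
  unfolding converges_stably_def weakly_converges_def
proof (intro conjI ballI impI allI)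
  show "future n \<in> borel_measurable M" if "n \<ge> 1" for n
    using that by (rule future_measurable)
  show rm: "random_measure M (iid_power \<alpha>)"
    by (rule random_measure_iid_power[OF random_measure_\<alpha>])
  fix H and g :: "(nat \<Rightarrow> 'e) \<Rightarrow> real"
  assume H: "H \<in> sets M" "prob H > 0" and g: "g \<in> bcontfun"
  let ?M = "uniform_measure M H"
  let ?D = "\<lambda>n. distr ?M borel (future (Suc n))"
  have H': "emeasure M H \<noteq> 0" "emeasure M H \<noteq> \<infinity>"
    using H(2) by (auto simp: emeasure_eq_measure)
  interpret U: prob_space ?M by (rule prob_space_uniform_measure[OF H'])
  have iid: "iid_power \<alpha> \<in> ?M \<rightarrow>\<^sub>M prob_algebra borel"
    using rm by (simp add: random_measure_def measurable_def)
  note iid' = measurable_prob_algebraD[OF iid]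
  have fut: "future (Suc n) \<in> borel_measurable ?M" for n
    using future_measurable[of "Suc n"] by (simp add: measurable_def)
  have prob_D: "prob_space (?D n)" for n
    by (rule U.prob_space_distr[OF fut])
  have D_int: "integrable (?D n) f" if "bounded_borel f" for n f
    by (rule integrable_bounded_borel[OF prob_D that]) simp
  \<comment> \<open>Rewrites averages under P( . | H) as integrals over \<open>H\<close> under
    \<open>M\<close>, where the conditional expectations live.\<close>
  have avg: "(\<integral>\<omega>. f \<omega> \<partial>?M) = (\<integral>\<omega>. indicator H \<omega> * f \<omega> \<partial>M) / prob H"
    if "f \<in> borel_measurable M" for f :: "'a \<Rightarrow> real"
  proof -
    have "?M = density M (\<lambda>\<omega>. ennreal (indicator H \<omega> / prob H))"
      unfolding uniform_measure_def using H(2)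
      by (intro density_cong AE_I2)
        (use H(1) divide_ennreal[of 1 "prob H"] in \<open>auto simp: emeasure_eq_measure split: split_indicator\<close>)
    then have "(\<integral>\<omega>. f \<omega> \<partial>?M) = (\<integral>\<omega>. (indicator H \<omega> / prob H) *\<^sub>R f \<omega> \<partial>M)"
      using that H by (simp add: integral_density del: scaleR_conv_of_real)
    then show ?thesis by simp
  qed
  interpret P: almost_surely_positive_functionals M
    "\<lambda>n g _. integral\<^sup>L (?D n) g" "\<lambda>_. bind ?M (iid_power \<alpha>)" open_cylinders
  proof (intro almost_surely_positive_functionals.intro almost_surely_positive_functionals_axioms.intro)
    fix R :: "(nat \<Rightarrow> 'e) set" assume Rc: "R \<in> open_cylinders"
    then obtain k U where R: "R = {x. \<forall>i<k. x i \<in> U i}" "\<forall>i. open (U i)"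
      by (rule open_cylindersE) blast
    have Rb: "R \<in> sets borel" by (rule open_cylinders_borel[OF Rc])
    let ?Y = "\<lambda>n \<omega>. \<Prod>i<k. indicator (U i) (X (Suc n + i) \<omega>) :: real"
    have "(\<lambda>n. \<integral>\<omega>. indicator H \<omega> * ?Y n \<omega> \<partial>M) \<longlonglongrightarrow>
        (\<integral>\<omega>. indicator H \<omega> * (\<Prod>i<k. measure (\<alpha> \<omega>) (U i)) \<partial>M)"
    proof (rule tendsto_integral_indicator_mult[OF H(1)])
      \<comment> \<open>\<open>?Y n\<close> reads \<open>X (n + 1)\<close> up to
        \<open>X (n + k)\<close>, whence the delay \<open>k\<close>.\<close>
      show "?Y n \<in> borel_measurable (G (n + k))" for n
      proof (rule borel_measurable_prod)
        fix i assume "i \<in> {..<k}"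
        then have "X (Suc n + i) \<in> borel_measurable (G (n + k))"
          by (intro measurable_G_mono[OF _ X_adapted]) auto
        then show "(\<lambda>\<omega>. indicator (U i) (X (Suc n + i) \<omega>) :: real) \<in> borel_measurable (G (n + k))"
          using R(2) by (intro measurable_compose[OF _ borel_measurable_indicator]) auto
      qed
      show "\<bar>?Y n \<omega>\<bar> \<le> 1" for n \<omega> by (rule abs_prod_le_1) simp
      show "(\<lambda>\<omega>. \<Prod>i<k. measure (\<alpha> \<omega>) (U i)) \<in> borel_measurable M"
        using R(2) by (intro borel_measurable_prod measurable_measure_random_measure[OF random_measure_\<alpha>]) simp
      show "AE \<omega> in M. (\<lambda>n. real_cond_exp M (G n) (?Y n) \<omega>) \<longlonglongrightarrow> (\<Prod>i<k. measure (\<alpha> \<omega>) (U i))"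
        using R(2) by (intro predictive_cylinder_tendsto) simp
    qed
    then have "(\<lambda>n. (\<integral>\<omega>. indicator H \<omega> * ?Y n \<omega> \<partial>M) / prob H) \<longlonglongrightarrow>
        (\<integral>\<omega>. indicator H \<omega> * (\<Prod>i<k. measure (\<alpha> \<omega>) (U i)) \<partial>M) / prob H"
      using H(2) by (intro tendsto_divide tendsto_const) auto
    moreover have "(\<integral>\<omega>. indicator H \<omega> * ?Y n \<omega> \<partial>M) / prob H = integral\<^sup>L (?D n) (indicator R)" for n
    proof -
      have "integral\<^sup>L (?D n) (indicator R :: _ \<Rightarrow> real) = (\<integral>\<omega>. indicator R (future (Suc n) \<omega>) \<partial>?M)"
        by (intro integral_distr fut borel_measurable_indicator Rb)
      also have "\<dots> = (\<integral>\<omega>. indicator H \<omega> * indicator R (future (Suc n) \<omega>) \<partial>M) / prob H"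
        by (intro avg measurable_compose[OF future_measurable] borel_measurable_indicator Rb) simp
      finally show ?thesis by (simp only: R(1) indicator_open_cylinder)
    qed
    moreover have "(\<integral>\<omega>. indicator H \<omega> * (\<Prod>i<k. measure (\<alpha> \<omega>) (U i)) \<partial>M) / prob H =
        measure (bind ?M (iid_power \<alpha>)) R"
    proof -
      have "measure (bind ?M (iid_power \<alpha>)) R = (\<integral>\<omega>. measure (iid_power \<alpha> \<omega>) R \<partial>?M)"
        by (rule U.measure_bind[OF iid' Rb])
      also have "\<dots> = (\<integral>\<omega>. indicator H \<omega> * measure (iid_power \<alpha> \<omega>) R \<partial>M) / prob H"
        by (intro avg measurable_measure_random_measure[OF rm] Rb)
      also have "(\<integral>\<omega>. indicator H \<omega> * measure (iid_power \<alpha> \<omega>) R \<partial>M) =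
          (\<integral>\<omega>. indicator H \<omega> * (\<Prod>i<k. measure (\<alpha> \<omega>) (U i)) \<partial>M)"
        unfolding R(1) using R(2)
        by (intro Bochner_Integration.integral_cong refl) (simp add: measure_iid_power[OF random_measure_\<alpha>])
      finally show ?thesis by simp
    qed
    ultimately show "AE \<omega> in M. (\<lambda>n. integral\<^sup>L (?D n) (indicator R)) \<longlonglongrightarrow> measure (bind ?M (iid_power \<alpha>)) R"
      by simp
  next
    show "prob_space (bind ?M (iid_power \<alpha>))"
      using prob_space_iid_power[OF random_measure_\<alpha>] by (intro U.prob_space_bind[OF _ iid'] AE_I2) simp
    show "sets (bind ?M (iid_power \<alpha>)) = sets borel"
      using U.not_empty by (intro sets_bind) (auto simp: sets_iid_power[OF random_measure_\<alpha>])
  next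
    show "R \<in> sets borel" if "R \<in> open_cylinders" for R :: "(nat \<Rightarrow> 'e) set"
      using that by (rule open_cylinders_borel)
    show "R \<inter> S \<in> open_cylinders" if "R \<in> open_cylinders" "S \<in> open_cylinders" for R S :: "(nat \<Rightarrow> 'e) set"
      using that by (rule open_cylinders_Int)
    show "\<exists>R::nat \<Rightarrow> _. range R \<subseteq> open_cylinders \<and> W = (\<Union>i. R i)" if "open W" for W :: "(nat \<Rightarrow> 'e) set"
      using that by (rule open_eq_UN_open_cylinders)
  next
    fix n and f h :: "(nat \<Rightarrow> 'e) \<Rightarrow> real"
    assume f: "bounded_borel f" and h: "bounded_borel h"
    show "AE _ in M. integral\<^sup>L (?D n) (\<lambda>x. f x + h x) = integral\<^sup>L (?D n) f + integral\<^sup>L (?D n) h"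
      by (intro AE_I2 Bochner_Integration.integral_add D_int f h)
    assume "\<And>x. f x \<le> h x"
    then show "AE _ in M. integral\<^sup>L (?D n) f \<le> integral\<^sup>L (?D n) h"
      by (intro AE_I2 integral_mono D_int f h)
  qed (rule prob_space_axioms open_cylinders_UNIV | simp)+
  have "AE \<omega> in M. (\<lambda>n. integral\<^sup>L (?D n) g) \<longlonglongrightarrow> integral\<^sup>L (bind ?M (iid_power \<alpha>)) g"
    by (rule P.AE_tendsto_bcontfun[OF g])
  then show "(\<lambda>n. integral\<^sup>L (?D n) g) \<longlonglongrightarrow> integral\<^sup>L (bind ?M (iid_power \<alpha>)) g"
    by simp
qed

end

theorem theorem2p5:
  fixes M :: "'a measure" and G :: "nat \<Rightarrow> 'a measure"
    and X :: "nat \<Rightarrow> 'a \<Rightarrow> 'e::polish_space" and \<alpha> :: "'a \<Rightarrow> 'e measure"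
  assumes "prob_space M"
    and "filtration (space M) G"
    and "\<And>n. subalgebra M (G n)"
    and "cid M G X"
    and "directing_measure M G X \<alpha>"
  shows "converges_stably M (\<lambda>n \<omega> i. X (n + i) \<omega>) (iid_power \<alpha>) \<and>
    (\<forall>g::(nat \<Rightarrow> 'e) \<Rightarrow> real. g \<in> bcontfun \<longrightarrow>
      (AE \<omega> in M.
        (\<lambda>n. real_cond_exp M (G n) (\<lambda>\<omega>'. g (\<lambda>i. X (n + 1 + i) \<omega>')) \<omega>)
          \<longlonglongrightarrow> (\<integral>x. g x \<partial>iid_power \<alpha> \<omega>)))"
proof -
  interpret prob_space M by fact
  interpret cid_sequence M G X \<alpha>
    by unfold_locales (use assms(3-5) filtration.sets_F_mono[OF assms(2)] in auto)
  show ?thesis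
    using stable_convergence predictive_tendsto_iid_power by simp
qed

end
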